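(* Let $n\ge1$ and let $\lambda\vdash a$, $\mu\vdash b$ be partitions with $a+b=n$. Let $\eta\phi\colon \mathbb C B_n\to\mathbb C B_n$ be the algebra automorphism of the group algebra of $B_n=G(2,1,n)$ defined in the context. Then $$\chi_{(\lambda,\mu)}\circ\eta\phi=\chi_{(\lambda,\mu^* )},$$ where $\mu^*$ is the partition dual (conjugate) to $\mu$.
   Context: $B_n=G(2,1,n)$ is the group of $n\times n$ monomial matrices with non-zero entries $\pm1$ (the Coxeter group of type $B_n$). $s_i$ ($1\le i\le n-1$) is the permutation matrix of the transposition $(i\ i+1)$, and $t_i$ ($1\le i\le n$) is the diagonal matrix with $(i,i)$ entry $-1$ and all other diagonal entries $1$. The map $\eta\phi$ is the $\mathbb C$-algebra automorphism of $\mathbb C B_n$ determined on generators by $\eta\phi(t_i)=t_i$ and $\eta\phi(s_i)=\frac12 s_i(1+t_i+t_{i+1}-t_it_{i+1})$. (Equivalently, with $\sigma_i=s_it_{i+1}$ and $\bar s_i=s_it_it_{i+1}$, it sends $\sigma_i\mapsto\frac12(s_i+\bar s_i+\sigma_i-\sigma_i^{-1})$ and fixes all diagonal matrices in $B_n$.) Irreducible complex characters of $B_n$ are labelled by bipartitions $(\lambda,\mu)$ of $n$, where $\lambda\vdash a$, $\mu\vdash b$, $a+b=n$: $\chi_{(\lambda,\mu)}=\mathrm{Ind}_{B_a\times B_b}^{B_n}(\tilde\chi_\lambda\boxtimes(\epsilon'_b\otimes\tilde\chi_\mu))$, where $\chi_\lambda$ is the irreducible character of the symmetric group $S_a$ labelled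 by $\lambda$ (with $\chi_{(a)}$ trivial), $\tilde\chi_\lambda$ is its pullback along the projection $B_a\to S_a$ killing the diagonal matrices (similarly for $\tilde\chi_\mu$), and $\epsilon'_b$ is the restriction to $B_b$ of the linear character $\epsilon'$ with $t_i\mapsto-1$, $s_i\mapsto1$. Here $B_a$ and $B_b$ are embedded as block-diagonal matrices. Characters are extended linearly to the group algebra. *)

theory Defs
  imports
    "HOL-Library.Function_Algebras"
    "HOL-Combinatorics.Permutations"
    "HOL-Algebra.Sym_Groups"
    "HOL-Algebra.QuotRing"
    "Jordan_Normal_Form.Matrix"
begin

section \<open>Group algebras and class functions\<close>

text \<open>
  The complex group algebra of a finite group \<open>G\<close> consists of the functions to \<open>complex\<close> that
  vanish outside \<open>carrier G\<close>, with convolution as product. Addition and zero are the pointwise ones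
  of \<open>Function_Algebras\<close>; the pointwise product of that theory is never used.
\<close>

definition group_algebra :: "('g, 'm) monoid_scheme \<Rightarrow> ('g \<Rightarrow> complex) ring" where
  "group_algebra G = \<lparr>
     carrier = {f. \<forall>g. g \<notin> carrier G \<longrightarrow> f g = 0},
     mult = (\<lambda>f f' g. \<Sum>(x, y) \<in> {(x, y). x \<in> carrier G \<and> y \<in> carrier G \<and> x \<otimes>\<^bsub>G\<^esub> y = g}. f x * f' y),
     one = (\<lambda>g. if g = \<one>\<^bsub>G\<^esub> then 1 else 0),
     zero = 0,
     add = (+)\<rparr>"

definition delta :: "'g \<Rightarrow> 'g \<Rightarrow> complex" where
  "delta g = (\<lambda>x. if x = g then 1 else 0)"

definition cscale :: "complex \<Rightarrow> ('g \<Rightarrow> complex) \<Rightarrow> 'g \<Rightarrow> complex" where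
  "cscale c f = (\<lambda>x. c * f x)"

definition algebra_auts :: "('g, 'm) monoid_scheme \<Rightarrow> (('g \<Rightarrow> complex) \<Rightarrow> ('g \<Rightarrow> complex)) set" where
  "algebra_auts G = {h. h \<in> ring_iso (group_algebra G) (group_algebra G) \<and>
     (\<forall>c. \<forall>f \<in> carrier (group_algebra G). h (cscale c f) = cscale c (h f))}"

definition linear_extension ::
    "('g, 'm) monoid_scheme \<Rightarrow> ('g \<Rightarrow> complex) \<Rightarrow> ('g \<Rightarrow> complex) \<Rightarrow> complex" where
  "linear_extension G \<chi> f = (\<Sum>g \<in> carrier G. f g * \<chi> g)"

definition induced_character ::
    "('g, 'm) monoid_scheme \<Rightarrow> 'g set \<Rightarrow> ('g \<Rightarrow> complex) \<Rightarrow> 'g \<Rightarrow> complex" where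
  "induced_character G H \<psi> g =
     (\<Sum>x \<in> {x \<in> carrier G. inv\<^bsub>G\<^esub> x \<otimes>\<^bsub>G\<^esub> g \<otimes>\<^bsub>G\<^esub> x \<in> H}. \<psi> (inv\<^bsub>G\<^esub> x \<otimes>\<^bsub>G\<^esub> g \<otimes>\<^bsub>G\<^esub> x))
       / of_nat (card H)"

text \<open>
  The trace of the endomorphism \<open>T\<close> of a finite-dimensional subspace \<open>V\<close>: the sum of the diagonal
  coefficients with respect to a basis \<open>B\<close> of \<open>V\<close> (the value does not depend on the choice).
\<close>

definition trace_on ::
    "('g \<Rightarrow> complex) set \<Rightarrow> (('g \<Rightarrow> complex) \<Rightarrow> ('g \<Rightarrow> complex)) \<Rightarrow> complex" where
  "trace_on V T =
     (let B = (SOME B. \<not> module.dependent cscale B \<and> module.span cscale B = V)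
      in \<Sum>b \<in> B. module.representation cscale B (T b) b)"


section \<open>Partitions and irreducible characters of the symmetric group\<close>

definition partition_of :: "nat \<Rightarrow> nat list \<Rightarrow> bool" where
  "partition_of n ms \<longleftrightarrow> sorted_wrt (\<ge>) ms \<and> 0 \<notin> set ms \<and> sum_list ms = n"

fun conjugate_partition :: "nat list \<Rightarrow> nat list" where
  "conjugate_partition [] = []"
| "conjugate_partition (m # ms) = map (\<lambda>j. length (filter (\<lambda>k. j < k) (m # ms))) [0..<m]"

text \<open>
  The boxes of the Young diagram of \<open>ms\<close> are numbered \<open>1, 2, \<dots>\<close> along the rows, from top to
  bottom; \<open>row_of\<close> and \<open>col_of\<close> locate the box with a given number (rows are counted from \<open>0\<close>,
  columns from \<open>1\<close>).
\<close>

definition row_of :: "nat list \<Rightarrow> nat \<Rightarrow> nat" where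
  "row_of ms k = (LEAST r. k \<le> sum_list (take (Suc r) ms))"

definition col_of :: "nat list \<Rightarrow> nat \<Rightarrow> nat" where
  "col_of ms k = k - sum_list (take (row_of ms k) ms)"

definition row_stabilizer :: "nat list \<Rightarrow> (nat \<Rightarrow> nat) set" where
  "row_stabilizer ms = {p \<in> carrier (sym_group (sum_list ms)).
     \<forall>k \<in> {1..sum_list ms}. row_of ms (p k) = row_of ms k}"

definition col_stabilizer :: "nat list \<Rightarrow> (nat \<Rightarrow> nat) set" where
  "col_stabilizer ms = {p \<in> carrier (sym_group (sum_list ms)).
     \<forall>k \<in> {1..sum_list ms}. col_of ms (p k) = col_of ms k}"

definition young_symmetrizer :: "nat list \<Rightarrow> (nat \<Rightarrow> nat) \<Rightarrow> complex" where
  "young_symmetrizer ms =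
     (\<Sum>p \<in> row_stabilizer ms. delta p)
       \<otimes>\<^bsub>group_algebra (sym_group (sum_list ms))\<^esub>
     (\<Sum>q \<in> col_stabilizer ms. cscale (of_int (sign q)) (delta q))"

text \<open>
  The Specht module of \<open>ms\<close> is realised as the left ideal of the group algebra generated by the
  Young symmetrizer. For the partition with a single part this is the trivial module.
\<close>

definition specht_module :: "nat list \<Rightarrow> ((nat \<Rightarrow> nat) \<Rightarrow> complex) set" where
  "specht_module ms =
     (let A = group_algebra (sym_group (sum_list ms))
      in (\<lambda>x. x \<otimes>\<^bsub>A\<^esub> young_symmetrizer ms) ` carrier A)"

definition sym_character :: "nat list \<Rightarrow> (nat \<Rightarrow> nat) \<Rightarrow> complex" where
  "sym_character ms p =
     trace_on (specht_module ms) (\<lambda>v. delta p \<otimes>\<^bsub>group_algebra (sym_group (sum_list ms))\<^esub> v)"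


section \<open>The groups of signed permutation matrices\<close>

text \<open>Matrix entries are indexed from \<open>0\<close>, whereas the generators and \<open>sym_group\<close> are indexed from \<open>1\<close>.\<close>

definition B_group :: "nat \<Rightarrow> int mat monoid" where
  "B_group n = \<lparr>
     carrier = {A \<in> carrier_mat n n.
       (\<forall>i<n. \<exists>!j. j < n \<and> A $$ (i, j) \<noteq> 0) \<and>
       (\<forall>j<n. \<exists>!i. i < n \<and> A $$ (i, j) \<noteq> 0) \<and>
       (\<forall>i<n. \<forall>j<n. A $$ (i, j) \<noteq> 0 \<longrightarrow> A $$ (i, j) \<in> {1, -1})},
     mult = (*),
     one = 1\<^sub>m n\<rparr>"

definition s_gen :: "nat \<Rightarrow> nat \<Rightarrow> int mat" where
  "s_gen n i = mat n n (\<lambda>(j, k). if Suc j = Transposition.transpose i (i + 1) (Suc k) then 1 else 0)"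

definition t_gen :: "nat \<Rightarrow> nat \<Rightarrow> int mat" where
  "t_gen n i = mat n n (\<lambda>(j, k). if j = k then (if Suc j = i then -1 else 1) else 0)"

text \<open>
  The projection from \<open>B_group n\<close> to \<open>sym_group n\<close>: the \<open>j\<close>-th column of \<open>A\<close> has its non-zero entry
  in row \<open>p j\<close>.
\<close>

definition B_proj :: "nat \<Rightarrow> int mat \<Rightarrow> nat \<Rightarrow> nat" where
  "B_proj n A =
     (THE p. p \<in> carrier (sym_group n) \<and> (\<forall>j \<in> {1..n}. A $$ (p j - 1, j - 1) \<noteq> 0))"

definition eps' :: "nat \<Rightarrow> int mat \<Rightarrow> complex" where
  "eps' n = (THE f. f \<in> extensional (carrier (B_group n)) \<and>
     (\<forall>A \<in> carrier (B_group n). f A \<noteq> 0) \<and>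
     (\<forall>A \<in> carrier (B_group n). \<forall>B \<in> carrier (B_group n). f (A * B) = f A * f B) \<and>
     (\<forall>i \<in> {1..n}. f (t_gen n i) = -1) \<and>
     (\<forall>i \<in> {1..<n}. f (s_gen n i) = 1))"

definition B_block :: "nat \<Rightarrow> nat \<Rightarrow> int mat set" where
  "B_block a b = {four_block_mat A (0\<^sub>m a b) (0\<^sub>m b a) D | A D.
     A \<in> carrier (B_group a) \<and> D \<in> carrier (B_group b)}"

definition B_block_character :: "nat list \<Rightarrow> nat list \<Rightarrow> int mat \<Rightarrow> complex" where
  "B_block_character ls ms M =
     (let a = sum_list ls; b = sum_list ms; (A, _, _, D) = split_block M a a
      in sym_character ls (B_proj a A) * (eps' b D * sym_character ms (B_proj b D)))"

definition B_character :: "nat list \<Rightarrow> nat list \<Rightarrow> int mat \<Rightarrow> complex" where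
  "B_character ls ms =
     (let a = sum_list ls; b = sum_list ms
      in induced_character (B_group (a + b)) (B_block a b) (B_block_character ls ms))"


section \<open>The automorphism\<close>

text \<open>
  Extensionality only fixes the value outside the group algebra, so that the map with the prescribed
  values on the generators is unique as a HOL function.
\<close>

definition eta_phi :: "nat \<Rightarrow> (int mat \<Rightarrow> complex) \<Rightarrow> (int mat \<Rightarrow> complex)" where
  "eta_phi n = (THE h. h \<in> extensional (carrier (group_algebra (B_group n))) \<and>
     h \<in> algebra_auts (B_group n) \<and>
     (\<forall>i \<in> {1..n}. h (delta (t_gen n i)) = delta (t_gen n i)) \<and>
     (\<forall>i \<in> {1..<n}. h (delta (s_gen n i)) =
        cscale (1/2) (delta (s_gen n i) \<otimes>\<^bsub>group_algebra (B_group n)\<^esub>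
          (delta (1\<^sub>m n) + delta (t_gen n i) + delta (t_gen n (i + 1))
             - delta (t_gen n i * t_gen n (i + 1))))))"

end

theory Submission
  imports Defs
begin

text \<open>
  Write an element of the group \<open>B_group n\<close> as \<open>p d\<close> with a permutation matrix \<open>p\<close> and a diagonal matrix
  \<open>d\<close>. The algebra of the diagonal subgroup has a basis of primitive idempotents \<open>e\<^sub>X\<close>, one for each
  \<open>X \<subseteq> {1..n}\<close>, where \<open>t\<^sub>i\<close> acts on \<open>e\<^sub>X\<close> by \<open>-1\<close> if \<open>i \<in> X\<close> and by \<open>1\<close> otherwise. Hence the elements
  \<open>p e\<^sub>X\<close> form a basis of the group algebra. The element \<open>(1 + t\<^sub>i + t\<^sub>i\<^sub>+\<^sub>1 - t\<^sub>i t\<^sub>i\<^sub>+\<^sub>1) / 2\<close> acts on \<open>e\<^sub>X\<close> by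
  \<open>-1\<close> if \<open>X\<close> contains both \<open>i\<close> and \<open>i + 1\<close>, and by \<open>1\<close> otherwise. This is the sign picked up by
  counting the inversions of the transposition \<open>s\<^sub>i\<close> that lie inside \<open>X\<close>. Since such signs satisfy the
  cocycle identity \<open>inversion_sign_comp\<close>, the automorphism \<open>eta_phi n\<close> is
  \<open>p e\<^sub>X \<mapsto> (-1) ^ k p e\<^sub>X\<close>, with \<open>k\<close> the number of inversions of \<open>p\<close> inside \<open>X\<close>
  (\<open>fourier_sign_twist\<close>, \<open>eta_phi_eq_sign_twist\<close>).
  
  On the other side, the character of the bipartition \<open>(\<lambda>, \<mu>)\<close> vanishes on \<open>p e\<^sub>X\<close> unless \<open>p X = X\<close> and
  \<open>X\<close> has \<open>b\<close> elements, and then it is, up to a common scalar, a sum over the permutations \<open>r\<close> with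
  \<open>r {a+1..a+b} = X\<close>: a value of \<open>\<chi>\<^sub>\<lambda>\<close> times the value of \<open>\<chi>\<^sub>\<mu>\<close> at the permutation that \<open>p\<close> induces
  on \<open>X\<close>, transported to \<open>{1..b}\<close> by \<open>r\<close> (\<open>linear_extension_B_character\<close>). The sign above is the sign of this permutation
  (\<open>inversion_sign_conj\<close>, \<open>sign_lower_part\<close>), whatever \<open>r\<close> is. So composing with \<open>eta_phi n\<close> replaces
  \<open>\<chi>\<^sub>\<mu>\<close> by \<open>sign \<cdot> \<chi>\<^sub>\<mu>\<close>, which is the character of the conjugate partition
  (\<open>sym_character_conjugate\<close>).
  
  The last fact is proved for Specht modules \<open>A a b\<close>, where \<open>A\<close> is the group algebra of the symmetric
  group, \<open>a\<close> is the sum of the row stabilizer and \<open>b\<close> is the signed sum of the column stabilizer.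
  Transposing the diagram exchanges rows and columns, so up to conjugation by a permutation the Young
  symmetrizer of the conjugate partition is the sign twist of \<open>b a\<close>. It remains to compare \<open>A b a\<close> with
  \<open>A a b\<close>, and \<open>b a\<close> is the adjoint of \<open>a b\<close> for the involution \<open>x\<^sup>* g = cnj (x (g\<^sup>-\<^sup>1))\<close>. For every \<open>x\<close>,
  right multiplication by \<open>x\<^sup>*\<close> maps \<open>A x\<close> injectively to \<open>A x\<^sup>*\<close>: if \<open>y x x\<^sup>* = 0\<close> then
  \<open>(y x) (y x)\<^sup>* = 0\<close>, whose coefficient at the identity is the sum of the \<open>|(y x) g|\<^sup>2\<close>. By symmetry and
  finite dimension these left ideals are isomorphic (\<open>trace_left_ideal_adjoint\<close>).
\<close>


section \<open>Traces of endomorphisms of finite-dimensional spaces of functions\<close>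

interpretation fs: vector_space "cscale :: complex \<Rightarrow> ('g \<Rightarrow> complex) \<Rightarrow> _"
  by unfold_locales (auto simp: cscale_def fun_eq_iff algebra_simps)

abbreviation clinear :: "(('g \<Rightarrow> complex) \<Rightarrow> ('h \<Rightarrow> complex)) \<Rightarrow> bool" where
  "clinear \<equiv> Vector_Spaces.linear cscale cscale"

lemma clinearI:
  assumes "\<And>v w. f (v + w) = f v + f w" "\<And>c v. f (cscale c v) = cscale c (f v)"
  shows "clinear f"
  using assms by (simp add: Vector_Spaces.linear_iff fs.vector_space_axioms)

lemma clinear_add: "clinear f \<Longrightarrow> f (v + w) = f v + f w"
  and clinear_scale: "clinear f \<Longrightarrow> f (cscale c v) = cscale c (f v)"
  by (auto simp: Vector_Spaces.linear_iff)

lemma clinear_module_hom: "clinear f \<Longrightarrow> module_hom cscale cscale f"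
  by (simp add: module_hom_iff_linear)

lemma clinear_sum: "clinear f \<Longrightarrow> f (sum g S) = (\<Sum>a\<in>S. f (g a))"
  by (rule module_hom.sum[OF clinear_module_hom])

lemma clinear_image_subspace: "clinear f \<Longrightarrow> fs.subspace V \<Longrightarrow> fs.subspace (f ` V)"
  by (rule module_hom.subspace_image[OF clinear_module_hom])

lemma sum_representation_linear:
  assumes C: "\<not> fs.dependent C" "finite C" and T: "clinear T" and v: "v \<in> fs.span C"
    and TC: "\<And>c. c \<in> C \<Longrightarrow> T c \<in> fs.span B" and B: "\<not> fs.dependent B"
  shows "fs.representation B (T v) b = (\<Sum>c\<in>C. fs.representation C v c * fs.representation B (T c) b)"
proof -
  have "T v = T (\<Sum>c\<in>C. cscale (fs.representation C v c) c)"
    using fs.sum_representation_eq[OF C(1) v C(2) subset_refl] by simp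
  also have "\<dots> = (\<Sum>c\<in>C. cscale (fs.representation C v c) (T c))"
    by (simp add: clinear_sum[OF T] clinear_scale[OF T])
  finally have *: "T v = (\<Sum>c\<in>C. cscale (fs.representation C v c) (T c))" .
  show ?thesis
    unfolding * using B TC
    by (simp add: fs.representation_sum fs.span_scale fs.representation_scale)
qed

text \<open>
  Expanding each \<open>b \<in> B\<close> in the basis \<open>C\<close> and each \<open>T c\<close> in the basis \<open>B\<close> turns both traces into the
  trace of a product of two coordinate matrices, taken in the two possible orders.
\<close>

lemma basis_trace_unique:
  assumes B: "\<not> fs.dependent B" "finite B" and C: "\<not> fs.dependent C" "finite C"
    and BC: "fs.span B = fs.span C" and T: "clinear T" "T ` fs.span C \<subseteq> fs.span C"
  shows "(\<Sum>b\<in>B. fs.representation B (T b) b) = (\<Sum>c\<in>C. fs.representation C (T c) c)"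
proof -
  have id: "clinear (\<lambda>v. v)" by (rule clinearI) auto
  have TC: "T c \<in> fs.span B" if "c \<in> C" for c
    using that T(2) BC fs.span_base by blast
  have TC': "T c \<in> fs.span C" if "c \<in> C" for c
    using TC[OF that] BC by simp
  have bC: "b \<in> fs.span C" if "b \<in> B" for b
    using that BC fs.span_base by blast
  have "(\<Sum>b\<in>B. fs.representation B (T b) b) =
      (\<Sum>b\<in>B. \<Sum>c\<in>C. fs.representation C b c * fs.representation B (T c) b)"
    by (intro sum.cong refl sum_representation_linear C T(1) bC TC B)
  also have "\<dots> = (\<Sum>c\<in>C. \<Sum>b\<in>B. fs.representation B (T c) b * fs.representation C b c)"
    by (subst sum.swap) (simp add: mult.commute)
  also have "\<dots> = (\<Sum>c\<in>C. fs.representation C (T c) c)"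
  proof (intro sum.cong refl)
    fix c assume "c \<in> C"
    show "(\<Sum>b\<in>B. fs.representation B (T c) b * fs.representation C b c) = fs.representation C (T c) c"
      by (rule sum_representation_linear[where T = "\<lambda>v. v", symmetric]) (use B id TC[OF \<open>c \<in> C\<close>] bC C in auto)
  qed
  finally show ?thesis .
qed

lemma trace_on_eq_basis_trace:
  assumes B: "\<not> fs.dependent B" "finite B" "fs.span B = V" and T: "clinear T" "T ` V \<subseteq> V"
  shows "trace_on V T = (\<Sum>b\<in>B. fs.representation B (T b) b)"
proof -
  define C where "C = (SOME B. \<not> fs.dependent B \<and> fs.span B = V)"
  have C: "\<not> fs.dependent C \<and> fs.span C = V"
    unfolding C_def by (rule someI[of _ B]) (use B in auto)
  have "finite C"
    using fs.independent_span_bound[OF B(2), of C] C B(3) fs.span_superset[of C] by auto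
  then show ?thesis
    unfolding trace_on_def C_def[symmetric] Let_def
    using basis_trace_unique[of C B T] C B T by auto
qed

lemma finite_basis_exists:
  assumes "fs.subspace V" "V \<subseteq> fs.span S" "finite S"
  obtains B where "\<not> fs.dependent B" "finite B" "fs.span B = V"
proof -
  obtain B where B: "B \<subseteq> V" "\<not> fs.dependent B" "V \<subseteq> fs.span B"
    using fs.maximal_independent_subset[of V] by blast
  moreover have "fs.span B = V"
    using fs.span_subspace[OF B(1,3) assms(1)] .
  moreover have "finite B"
    using fs.independent_span_bound[OF assms(3) B(2)] B(1) assms(2) by auto
  ultimately show ?thesis using that by blast
qed

text \<open>
  An isomorphism carries a basis of \<open>V\<close> to a basis of \<open>W\<close> with the same coordinates. In
  particular isomorphic modules have the same traces.
\<close>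

lemma trace_on_transport:
  fixes V :: "('g \<Rightarrow> complex) set" and W :: "('h \<Rightarrow> complex) set"
  assumes V: "fs.subspace V" "V \<subseteq> fs.span S" "finite S"
    and \<phi>: "clinear \<phi>" "inj_on \<phi> V" "\<phi> ` V = W"
    and T: "clinear T" "T ` V \<subseteq> V" and U: "clinear U"
    and eq: "\<And>v. v \<in> V \<Longrightarrow> \<phi> (T v) = U (\<phi> v)"
  shows "trace_on W U = trace_on V T"
proof -
  obtain B where B: "\<not> fs.dependent B" "finite B" "fs.span B = V"
    using finite_basis_exists[OF V] by blast
  have BV: "B \<subseteq> V" using B(3) fs.span_superset by blast
  have mh: "module_hom cscale cscale \<phi>" using \<phi>(1) by (rule clinear_module_hom)
  have ind: "\<not> fs.dependent (\<phi> ` B)"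
    using module_hom.independent_injective_image[OF mh B(1)] \<phi>(2) B(3) by simp
  have span: "fs.span (\<phi> ` B) = W"
    using module_hom.span_image[OF mh, of B] B(3) \<phi>(3) by simp
  have UW: "U ` W \<subseteq> W"
    using T(2) by (auto simp: eq[symmetric] simp flip: \<phi>(3))
  have rep: "fs.representation (\<phi> ` B) (\<phi> v) (\<phi> b) = fs.representation B v b"
    if v: "v \<in> V" and b: "b \<in> B" for v b
  proof -
    have inj: "inj_on \<phi> B" using \<phi>(2) BV inj_on_subset by blast
    have "fs.representation (\<phi> ` B) (\<phi> v) (\<phi> b) =
        (\<Sum>c\<in>B. fs.representation B v c * fs.representation (\<phi> ` B) (\<phi> c) (\<phi> b))"
      using v B(3) by (intro sum_representation_linear B \<phi>(1) ind) (auto intro: fs.span_base)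
    also have "\<dots> = (\<Sum>c\<in>B. if c = b then fs.representation B v c else 0)"
      using inj b by (intro sum.cong refl)
        (auto simp: fs.representation_basis[OF ind] inj_on_eq_iff)
    also have "\<dots> = fs.representation B v b"
      using b B(2) by simp
    finally show ?thesis .
  qed
  have "trace_on W U = (\<Sum>b\<in>\<phi> ` B. fs.representation (\<phi> ` B) (U b) b)"
    using B(2) by (intro trace_on_eq_basis_trace ind span U UW) auto
  also have "\<dots> = (\<Sum>b\<in>B. fs.representation (\<phi> ` B) (U (\<phi> b)) (\<phi> b))"
    using \<phi>(2) BV by (subst sum.reindex) (auto intro: inj_on_subset)
  also have "\<dots> = (\<Sum>b\<in>B. fs.representation B (T b) b)"
  proof (intro sum.cong refl)
    fix b assume b: "b \<in> B"
    then show "fs.representation (\<phi> ` B) (U (\<phi> b)) (\<phi> b) = fs.representation B (T b) b"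
      using rep[OF subsetD[OF T(2) imageI[OF subsetD[OF BV b]]] b] eq[OF subsetD[OF BV b]] by simp
  qed
  also have "\<dots> = trace_on V T"
    by (rule trace_on_eq_basis_trace[symmetric]) (use B T in auto)
  finally show ?thesis .
qed

lemma trace_on_scale:
  assumes V: "fs.subspace V" "V \<subseteq> fs.span S" "finite S"
    and T: "clinear T" "T ` V \<subseteq> V"
  shows "trace_on V (\<lambda>v. cscale c (T v)) = c * trace_on V T"
proof -
  obtain B where B: "\<not> fs.dependent B" "finite B" "fs.span B = V"
    using finite_basis_exists[OF V] by blast
  have BV: "B \<subseteq> V" using B(3) fs.span_superset by blast
  have "clinear (\<lambda>v. cscale c (T v))"
    using T(1) by (intro clinearI) (simp_all add: clinear_add clinear_scale, simp_all add: cscale_def fun_eq_iff algebra_simps)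
  then have "trace_on V (\<lambda>v. cscale c (T v)) = (\<Sum>b\<in>B. fs.representation B (cscale c (T b)) b)"
    using T(2) V(1) by (intro trace_on_eq_basis_trace B) (auto intro: fs.subspace_scale)
  also have "\<dots> = (\<Sum>b\<in>B. c * fs.representation B (T b) b)"
    using BV T(2) by (intro sum.cong refl, subst fs.representation_scale[OF B(1)]) (auto simp: B(3))
  also have "\<dots> = c * trace_on V T"
    by (simp add: trace_on_eq_basis_trace[OF B T] sum_distrib_left)
  finally show ?thesis .
qed

text \<open>
  The image of a basis together with a vector outside the image would be an independent set with too
  many elements.
\<close>

lemma injective_endomorphism_onto:
  assumes V: "fs.subspace V" "V \<subseteq> fs.span S" "finite S"
    and T: "clinear T" "T ` V \<subseteq> V" "inj_on T V"
  shows "T ` V = V"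
proof (rule ccontr)
  assume "T ` V \<noteq> V"
  then obtain v where v: "v \<in> V" "v \<notin> T ` V" using T(2) by blast
  obtain B where B: "\<not> fs.dependent B" "finite B" "fs.span B = V"
    using finite_basis_exists[OF V] by blast
  have BV: "B \<subseteq> V" using B(3) fs.span_superset by blast
  have mh: "module_hom cscale cscale T" using T(1) by (rule clinear_module_hom)
  have ind: "\<not> fs.dependent (T ` B)"
    using module_hom.independent_injective_image[OF mh B(1)] T(3) B(3) by simp
  have "fs.span (T ` B) = T ` V"
    using module_hom.span_image[OF mh, of B] B(3) by simp
  then have "\<not> fs.dependent (insert v (T ` B))"
    using fs.independent_insertI[OF _ ind, of v] v by simp
  moreover have "insert v (T ` B) \<subseteq> fs.span B"
    using v BV T(2) B(3) by auto
  ultimately have "card (insert v (T ` B)) \<le> card B"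
    using fs.independent_span_bound[OF B(2)] by blast
  moreover have "v \<notin> T ` B" using v BV by blast
  moreover have "card (T ` B) = card B"
    using T(3) BV by (intro card_image) (auto intro: inj_on_subset)
  ultimately show False using B(2) by simp
qed


section \<open>The group algebra of a finite group\<close>

locale finite_group = group G for G (structure) +
  assumes finite_carrier: "finite (carrier G)"
begin

abbreviation conv :: "('a \<Rightarrow> complex) \<Rightarrow> ('a \<Rightarrow> complex) \<Rightarrow> 'a \<Rightarrow> complex" (infixl "\<star>" 70) where
  "f \<star> f' \<equiv> f \<otimes>\<^bsub>group_algebra G\<^esub> f'"

abbreviation alg :: "('a \<Rightarrow> complex) set" where
  "alg \<equiv> carrier (group_algebra G)"

lemma alg_iff: "f \<in> alg \<longleftrightarrow> (\<forall>g. g \<notin> carrier G \<longrightarrow> f g = 0)"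
  by (simp add: group_algebra_def)

lemma conv_apply:
  "(f \<star> f') z = (\<Sum>x\<in>carrier G. \<Sum>y\<in>carrier G. if x \<otimes> y = z then f x * f' y else 0)"
proof -
  have "(f \<star> f') z = (\<Sum>(x, y)\<in>{(x, y). x \<in> carrier G \<and> y \<in> carrier G \<and> x \<otimes> y = z}. f x * f' y)"
    by (simp add: group_algebra_def)
  also have "\<dots> = (\<Sum>(x, y)\<in>carrier G \<times> carrier G. if x \<otimes> y = z then f x * f' y else 0)"
    using finite_carrier by (intro sum.mono_neutral_cong_left) (auto split: if_splits)
  finally show ?thesis by (simp add: sum.cartesian_product)
qed

text \<open>
  The basic tool for computing with convolutions: a linear functional on a product is a double sum
  over the group, without the fibres of the multiplication that occur in the definition.
\<close>

lemma linear_extension_conv: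
  "linear_extension G \<phi> (f \<star> f') = (\<Sum>x\<in>carrier G. \<Sum>y\<in>carrier G. f x * f' y * \<phi> (x \<otimes> y))"
proof -
  have "linear_extension G \<phi> (f \<star> f') =
      (\<Sum>z\<in>carrier G. \<Sum>x\<in>carrier G. \<Sum>y\<in>carrier G. if x \<otimes> y = z then f x * f' y * \<phi> z else 0)"
    unfolding linear_extension_def conv_apply
    by (auto simp: sum_distrib_right intro!: sum.cong)
  also have "\<dots> = (\<Sum>x\<in>carrier G. \<Sum>z\<in>carrier G. \<Sum>y\<in>carrier G. if x \<otimes> y = z then f x * f' y * \<phi> z else 0)"
    by (rule sum.swap)
  also have "\<dots> = (\<Sum>x\<in>carrier G. \<Sum>y\<in>carrier G. \<Sum>z\<in>carrier G. if x \<otimes> y = z then f x * f' y * \<phi> z else 0)"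
    by (intro sum.cong refl sum.swap)
  also have "\<dots> = (\<Sum>x\<in>carrier G. \<Sum>y\<in>carrier G. f x * f' y * \<phi> (x \<otimes> y))"
    using finite_carrier by (intro sum.cong refl) simp
  finally show ?thesis .
qed

lemma apply_eq_linear_extension:
  "z \<in> carrier G \<Longrightarrow> f z = linear_extension G (\<lambda>x. if x = z then 1 else 0) f"
  using finite_carrier by (simp add: linear_extension_def if_distrib cong: if_cong)

lemma conv_in_alg [simp]: "f \<star> f' \<in> alg"
  by (auto simp: alg_iff conv_apply intro!: sum.neutral)

lemma alg_eqI:
  assumes "f \<in> alg" "f' \<in> alg" "\<And>z. z \<in> carrier G \<Longrightarrow> f z = f' z"
  shows "f = f'"
  using assms unfolding alg_iff by (intro ext) metis

lemma conv_assoc: "(f \<star> g) \<star> h = f \<star> (g \<star> h)"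
proof (rule alg_eqI)
  fix z assume z: "z \<in> carrier G"
  let ?\<delta> = "\<lambda>x. if x = z then 1 else (0::complex)"
  let ?S = "\<lambda>u. (\<Sum>x\<in>carrier G. u x)"
  have "((f \<star> g) \<star> h) z = ?S (\<lambda>x. ?S (\<lambda>y. (f \<star> g) x * h y * ?\<delta> (x \<otimes> y)))"
    by (simp only: apply_eq_linear_extension[OF z, of "_ \<star> h"] linear_extension_conv)
  also have "\<dots> = ?S (\<lambda>y. h y * linear_extension G (\<lambda>x. ?\<delta> (x \<otimes> y)) (f \<star> g))"
    by (subst sum.swap) (auto simp: linear_extension_def sum_distrib_left intro!: sum.cong)
  also have "\<dots> = ?S (\<lambda>y. ?S (\<lambda>a. ?S (\<lambda>b. f a * g b * h y * ?\<delta> (a \<otimes> b \<otimes> y))))"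
    unfolding linear_extension_conv sum_distrib_left
    by (intro sum.cong refl) (simp add: algebra_simps)
  also have "\<dots> = ?S (\<lambda>a. ?S (\<lambda>y. ?S (\<lambda>b. f a * g b * h y * ?\<delta> (a \<otimes> b \<otimes> y))))"
    by (rule sum.swap)
  also have "\<dots> = ?S (\<lambda>a. ?S (\<lambda>b. ?S (\<lambda>y. f a * g b * h y * ?\<delta> (a \<otimes> b \<otimes> y))))"
    by (intro sum.cong refl sum.swap)
  also have "\<dots> = ?S (\<lambda>a. f a * ?S (\<lambda>b. ?S (\<lambda>y. g b * h y * ?\<delta> (a \<otimes> (b \<otimes> y)))))"
    unfolding sum_distrib_left by (intro sum.cong refl) (simp add: algebra_simps m_assoc)
  also have "\<dots> = ?S (\<lambda>a. f a * linear_extension G (\<lambda>x. ?\<delta> (a \<otimes> x)) (g \<star> h))"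
    by (simp only: linear_extension_conv)
  also have "\<dots> = ?S (\<lambda>a. ?S (\<lambda>x. f a * (g \<star> h) x * ?\<delta> (a \<otimes> x)))"
    by (simp add: linear_extension_def sum_distrib_left mult.assoc)
  also have "\<dots> = (f \<star> (g \<star> h)) z"
    by (simp only: apply_eq_linear_extension[OF z, of "f \<star> _"] linear_extension_conv)
  finally show "((f \<star> g) \<star> h) z = (f \<star> (g \<star> h)) z" .
qed auto

lemma conv_add_left: "(f + g) \<star> h = f \<star> h + g \<star> h"
  and conv_add_right: "f \<star> (g + h) = f \<star> g + f \<star> h"
  by (auto simp: fun_eq_iff conv_apply algebra_simps simp flip: sum.distrib intro!: sum.cong)

lemma zero_conv [simp]: "0 \<star> f = 0"
  by (rule ext) (simp add: conv_apply cong: if_cong)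

lemma conv_cscale_left: "cscale c f \<star> g = cscale c (f \<star> g)"
  and conv_cscale_right: "f \<star> cscale c g = cscale c (f \<star> g)"
  by (auto simp: fun_eq_iff conv_apply cscale_def sum_distrib_left intro!: sum.cong)

lemma clinear_conv_left: "clinear (\<lambda>v. f \<star> v)"
  and clinear_conv_right: "clinear (\<lambda>v. v \<star> f)"
  by (auto intro!: clinearI simp: conv_add_left conv_add_right conv_cscale_left conv_cscale_right)

lemma delta_in_alg [simp]: "g \<in> carrier G \<Longrightarrow> delta g \<in> alg"
  by (auto simp: alg_iff delta_def)

lemma delta_conv_delta:
  assumes "g \<in> carrier G" "h \<in> carrier G"
  shows "delta g \<star> delta h = delta (g \<otimes> h)"
proof
  fix z
  have "(delta g \<star> delta h) z = (\<Sum>x\<in>carrier G. \<Sum>y\<in>carrier G. if y = h then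
      (if x = g then if g \<otimes> h = z then 1 else 0 else 0) else 0)"
    unfolding conv_apply by (intro sum.cong refl) (auto simp: delta_def)
  then show "(delta g \<star> delta h) z = delta (g \<otimes> h) z"
    using assms finite_carrier by (simp add: delta_def)
qed

lemma conv_delta_one [simp]:
  assumes "f \<in> alg"
  shows "f \<star> delta \<one> = f" "delta \<one> \<star> f = f"
proof -
  have "(f \<star> delta \<one>) z = f z" if z: "z \<in> carrier G" for z
  proof -
    have "(f \<star> delta \<one>) z = (\<Sum>x\<in>carrier G. \<Sum>y\<in>carrier G. if y = \<one> then if x = z then f z else 0 else 0)"
      unfolding conv_apply by (intro sum.cong refl) (auto simp: delta_def)
    then show ?thesis using finite_carrier z by simp
  qed
  then show "f \<star> delta \<one> = f" using assms by (intro alg_eqI) auto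
  have "(delta \<one> \<star> f) z = f z" if z: "z \<in> carrier G" for z
  proof -
    have "(delta \<one> \<star> f) z = (\<Sum>x\<in>carrier G. \<Sum>y\<in>carrier G. if y = z then if x = \<one> then f z else 0 else 0)"
      unfolding conv_apply by (intro sum.cong refl) (auto simp: delta_def)
    then show ?thesis using finite_carrier z by simp
  qed
  then show "delta \<one> \<star> f = f" using assms by (intro alg_eqI) auto
qed

lemma alg_subspace: "fs.subspace alg"
  by (rule fs.subspaceI) (auto simp: alg_iff cscale_def)

lemma alg_expand:
  assumes "f \<in> alg"
  shows "f = (\<Sum>g\<in>carrier G. cscale (f g) (delta g))"
proof
  fix z
  have "(\<Sum>g\<in>A. cscale (f g) (delta g)) z = (\<Sum>g\<in>A. if g = z then f z else 0)" if "finite A" for A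
    using that by induct (auto simp: cscale_def delta_def)
  from this[OF finite_carrier] show "f z = (\<Sum>g\<in>carrier G. cscale (f g) (delta g)) z"
    using assms finite_carrier by (auto simp: alg_iff)
qed

lemma alg_subset_span: "alg \<subseteq> fs.span (delta ` carrier G)"
proof
  fix f assume "f \<in> alg"
  then have "f = (\<Sum>g\<in>carrier G. cscale (f g) (delta g))" by (rule alg_expand)
  also have "\<dots> \<in> fs.span (delta ` carrier G)"
    by (intro fs.span_sum fs.span_scale fs.span_base) auto
  finally show "f \<in> fs.span (delta ` carrier G)" .
qed

definition left_ideal :: "('a \<Rightarrow> complex) \<Rightarrow> ('a \<Rightarrow> complex) set" where
  "left_ideal x = (\<lambda>y. y \<star> x) ` alg"

lemma left_ideal_subspace: "fs.subspace (left_ideal x)"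
  unfolding left_ideal_def
  by (rule clinear_image_subspace[OF clinear_conv_right alg_subspace])

lemma left_ideal_fin: "left_ideal x \<subseteq> fs.span (delta ` carrier G)" "finite (delta ` carrier G)"
  using alg_subset_span finite_carrier by (auto simp: left_ideal_def)

lemma left_ideal_closed: "v \<in> left_ideal x \<Longrightarrow> f \<star> v \<in> left_ideal x"
  unfolding left_ideal_def by (auto simp flip: conv_assoc)

lemma left_ideal_in_alg: "v \<in> left_ideal x \<Longrightarrow> v \<in> alg"
  unfolding left_ideal_def by auto

definition adjoint :: "('a \<Rightarrow> complex) \<Rightarrow> 'a \<Rightarrow> complex" where
  "adjoint f = (\<lambda>g. if g \<in> carrier G then cnj (f (inv g)) else 0)"

lemma adjoint_in_alg [simp]: "adjoint f \<in> alg"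
  by (simp add: adjoint_def alg_iff)

lemma adjoint_adjoint [simp]: "f \<in> alg \<Longrightarrow> adjoint (adjoint f) = f"
  by (rule alg_eqI) (simp, simp, simp add: adjoint_def)

lemma sum_inv: "(\<Sum>x\<in>carrier G. u (inv x)) = (\<Sum>x\<in>carrier G. u x)"
  by (rule sum.reindex_bij_witness[of _ "\<lambda>x. inv x" "\<lambda>x. inv x"]) auto

lemma adjoint_conv: "adjoint (f \<star> g) = adjoint g \<star> adjoint f"
proof (rule alg_eqI)
  fix z assume z: "z \<in> carrier G"
  have "adjoint (f \<star> g) z = (\<Sum>x\<in>carrier G. \<Sum>y\<in>carrier G. if x \<otimes> y = inv z then cnj (f x) * cnj (g y) else 0)"
    using z by (auto simp: adjoint_def conv_apply intro!: sum.cong)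
  also have "\<dots> = (\<Sum>x\<in>carrier G. \<Sum>y\<in>carrier G. if inv x \<otimes> y = inv z then cnj (f (inv x)) * cnj (g y) else 0)"
    by (rule sum_inv[symmetric])
  also have "\<dots> = (\<Sum>x\<in>carrier G. \<Sum>y\<in>carrier G. if inv x \<otimes> inv y = inv z then cnj (f (inv x)) * cnj (g (inv y)) else 0)"
    by (intro sum.cong refl sum_inv[symmetric])
  also have "\<dots> = (\<Sum>x\<in>carrier G. \<Sum>y\<in>carrier G. if y \<otimes> x = z then adjoint g y * adjoint f x else 0)"
    using z by (intro sum.cong refl) (auto simp: adjoint_def inv_mult_group[symmetric] dest: inv_inj[THEN inj_onD])
  also have "\<dots> = (adjoint g \<star> adjoint f) z"
    unfolding conv_apply by (rule sum.swap)
  finally show "adjoint (f \<star> g) z = (adjoint g \<star> adjoint f) z" .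
qed auto

text \<open>
  The coefficient of \<open>f \<star> adjoint f\<close> at the identity is the squared norm of \<open>f\<close>.
\<close>

lemma conv_adjoint_eq_0:
  assumes "f \<in> alg" "f \<star> adjoint f = 0"
  shows "f = 0"
proof -
  have "(f \<star> adjoint f) \<one> = (\<Sum>x\<in>carrier G. \<Sum>y\<in>carrier G. if y = inv x then f x * cnj (f x) else 0)"
    unfolding conv_apply
    by (intro sum.cong refl) (auto simp: adjoint_def inv_equality dest: inv_equality)
  also have "\<dots> = (\<Sum>x\<in>carrier G. f x * cnj (f x))"
    using finite_carrier by simp
  also have "\<dots> = of_real (\<Sum>x\<in>carrier G. (cmod (f x))\<^sup>2)"
    by (simp add: complex_norm_square flip: of_real_power)
  finally have "(\<Sum>x\<in>carrier G. (cmod (f x))\<^sup>2) = 0"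
    using assms(2) by (metis of_real_eq_0_iff zero_fun_apply)
  then have "\<forall>x\<in>carrier G. f x = 0"
    using finite_carrier by (simp add: sum_nonneg_eq_0_iff)
  then show ?thesis using assms(1) by (auto simp: alg_iff fun_eq_iff)
qed

lemma inj_on_left_ideal_adjoint:
  assumes "x \<in> alg" shows "inj_on (\<lambda>v. v \<star> adjoint x) (left_ideal x)"
proof -
  have mh: "module_hom cscale cscale (\<lambda>v. v \<star> adjoint x)"
    by (rule clinear_module_hom[OF clinear_conv_right])
  show ?thesis
    unfolding module_hom.inj_on_iff_eq_0[OF mh left_ideal_subspace]
  proof (intro ballI impI)
    fix v assume "v \<in> left_ideal x" and 0: "v \<star> adjoint x = 0"
    then obtain y where v: "v = y \<star> x" "y \<in> alg" by (auto simp: left_ideal_def)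
    \<comment> \<open>For \<open>v = y \<star> x\<close> the adjoint of \<open>v\<close> has \<open>adjoint x\<close> as its left factor.\<close>
    have "v \<star> adjoint v = (v \<star> adjoint x) \<star> adjoint y"
      by (simp add: v adjoint_conv conv_assoc)
    also have "\<dots> = 0" by (simp add: 0)
    finally show "v = 0" using conv_adjoint_eq_0[of v] v by simp
  qed
qed

text \<open>
  The map \<open>v \<mapsto> v \<star> adjoint x\<close> is a homomorphism from \<open>left_ideal x\<close> to \<open>left_ideal (adjoint x)\<close>. It is
  injective by positivity, and so is the analogous map in the other direction. Their composite is an
  injective endomorphism of a finite-dimensional space, hence onto, so both maps are isomorphisms.
\<close>

lemma trace_left_ideal_adjoint:
  assumes x: "x \<in> alg"
  shows "trace_on (left_ideal (adjoint x)) (\<lambda>v. f \<star> v) = trace_on (left_ideal x) (\<lambda>v. f \<star> v)"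
proof (rule trace_on_transport[OF left_ideal_subspace left_ideal_fin, where \<phi> = "\<lambda>v. v \<star> adjoint x"])
  let ?R = "\<lambda>v. v \<star> adjoint x" and ?L = "\<lambda>v. v \<star> x"
  show inj: "inj_on ?R (left_ideal x)" by (rule inj_on_left_ideal_adjoint[OF x])
  have inj': "inj_on ?L (left_ideal (adjoint x))"
    using inj_on_left_ideal_adjoint[of "adjoint x"] x by simp
  have sub: "?R ` left_ideal x \<subseteq> left_ideal (adjoint x)" and sub': "?L ` left_ideal (adjoint x) \<subseteq> left_ideal x"
    by (auto simp: left_ideal_def)
  \<comment> \<open>Surjectivity of the composite gives surjectivity of \<open>?R\<close>.\<close>
  have "(?R \<circ> ?L) ` left_ideal (adjoint x) = left_ideal (adjoint x)"
  proof (rule injective_endomorphism_onto[OF left_ideal_subspace left_ideal_fin])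
    show "clinear (?R \<circ> ?L)"
      using clinear_conv_right[of x] clinear_conv_right[of "adjoint x"]
      by (intro clinearI) (auto simp: clinear_add clinear_scale conv_add_left conv_cscale_left)
    show "inj_on (?R \<circ> ?L) (left_ideal (adjoint x))"
      using inj' inj sub' by (intro comp_inj_on) (auto intro: inj_on_subset)
    show "(?R \<circ> ?L) ` left_ideal (adjoint x) \<subseteq> left_ideal (adjoint x)"
      using sub sub' by fastforce
  qed
  then show "?R ` left_ideal x = left_ideal (adjoint x)"
    using sub sub' unfolding image_comp[symmetric] by blast
qed (auto intro: clinear_conv_right clinear_conv_left left_ideal_closed
      simp: conv_assoc)

lemma trace_left_ideal_conv_delta:
  assumes g: "g \<in> carrier G" and x: "x \<in> alg"
  shows "trace_on (left_ideal (x \<star> delta g)) (\<lambda>v. f \<star> v) = trace_on (left_ideal x) (\<lambda>v. f \<star> v)"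
proof (rule trace_on_transport[OF left_ideal_subspace left_ideal_fin, where \<phi> = "\<lambda>v. v \<star> delta g"])
  show "inj_on (\<lambda>v. v \<star> delta g) (left_ideal x)"
  proof (rule inj_on_inverseI[where g = "\<lambda>v. v \<star> delta (inv g)"])
    fix v assume "v \<in> left_ideal x"
    then show "v \<star> delta g \<star> delta (inv g) = v"
      using g by (simp add: conv_assoc delta_conv_delta left_ideal_in_alg)
  qed
  show "(\<lambda>v. v \<star> delta g) ` left_ideal x = left_ideal (x \<star> delta g)"
    by (auto simp: left_ideal_def image_image conv_assoc)
qed (auto intro: clinear_conv_right clinear_conv_left left_ideal_closed
      simp: conv_assoc)

lemma left_ideal_delta_conv:
  assumes g: "g \<in> carrier G"
  shows "left_ideal (delta g \<star> x) = left_ideal x"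
proof -
  have "(\<lambda>y. y \<star> delta g) ` alg = alg"
  proof (intro equalityI subsetI)
    fix y assume "y \<in> alg"
    then have "y = (y \<star> delta (inv g)) \<star> delta g"
      using g by (simp add: conv_assoc delta_conv_delta)
    then show "y \<in> (\<lambda>y. y \<star> delta g) ` alg"
      using conv_in_alg by blast
  qed auto
  then show ?thesis
    unfolding left_ideal_def by (metis (no_types, lifting) conv_assoc image_cong image_image)
qed

lemma delta_conv_apply:
  assumes "w \<in> carrier G" "z \<in> carrier G"
  shows "(delta w \<star> f) z = f (inv w \<otimes> z)"
proof -
  have "(delta w \<star> f) z = (\<Sum>x\<in>carrier G. \<Sum>y\<in>carrier G.
      if y = inv w \<otimes> z then if x = w then f (inv w \<otimes> z) else 0 else 0)"
    unfolding conv_apply using assms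
    by (intro sum.cong refl) (auto simp: delta_def simp flip: m_assoc)
  then show ?thesis using finite_carrier assms by simp
qed

lemma conv_delta_apply:
  assumes "w \<in> carrier G" "z \<in> carrier G"
  shows "(f \<star> delta w) z = f (z \<otimes> inv w)"
proof -
  have "(f \<star> delta w) z = (\<Sum>x\<in>carrier G. \<Sum>y\<in>carrier G.
      if y = w then if x = z \<otimes> inv w then f (z \<otimes> inv w) else 0 else 0)"
    unfolding conv_apply using assms
    by (intro sum.cong refl) (auto simp: delta_def m_assoc)
  then show ?thesis using finite_carrier assms by simp
qed

text \<open>
  For a linear character \<open>\<chi>\<close> this is the automorphism \<open>g \<mapsto> \<chi> g \<cdot> g\<close> of the group algebra.
\<close>

definition twist :: "('a \<Rightarrow> complex) \<Rightarrow> ('a \<Rightarrow> complex) \<Rightarrow> 'a \<Rightarrow> complex" where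
  "twist \<chi> f = (\<lambda>g. \<chi> g * f g)"

lemma twist_in_alg: "f \<in> alg \<Longrightarrow> twist \<chi> f \<in> alg"
  by (simp add: alg_iff twist_def)

lemma clinear_twist: "clinear (twist \<chi>)"
  by (intro clinearI) (simp_all add: twist_def fun_eq_iff cscale_def algebra_simps)

lemma twist_conv:
  assumes "\<And>x y. x \<in> carrier G \<Longrightarrow> y \<in> carrier G \<Longrightarrow> \<chi> (x \<otimes> y) = \<chi> x * \<chi> y"
  shows "twist \<chi> (f \<star> g) = twist \<chi> f \<star> twist \<chi> g"
  unfolding twist_def conv_apply fun_eq_iff sum_distrib_left
  using assms by (auto intro!: sum.cong)

text \<open>
  The twist identifies the two left ideals but intertwines multiplication by \<open>g\<close> with multiplication
  by \<open>\<chi> g \<cdot> g\<close>. The hypothesis that \<open>\<chi>\<close> takes the values \<open>1\<close> and \<open>-1\<close> makes the twist an involution.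
\<close>

lemma trace_left_ideal_twist:
  assumes hom: "\<And>x y. x \<in> carrier G \<Longrightarrow> y \<in> carrier G \<Longrightarrow> \<chi> (x \<otimes> y) = \<chi> x * \<chi> y"
    and sq: "\<And>x. x \<in> carrier G \<Longrightarrow> \<chi> x * \<chi> x = 1"
    and g: "g \<in> carrier G"
  shows "trace_on (left_ideal (twist \<chi> x)) (\<lambda>v. delta g \<star> v)
    = \<chi> g * trace_on (left_ideal x) (\<lambda>v. delta g \<star> v)"
proof -
  have tt: "twist \<chi> (twist \<chi> f) = f" if "f \<in> alg" for f
    using that by (intro alg_eqI twist_in_alg) (simp_all add: twist_def sq flip: mult.assoc)
  have td: "twist \<chi> (delta g) = cscale (\<chi> g) (delta g)"
    by (auto simp: twist_def delta_def cscale_def)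
  have "trace_on (left_ideal (twist \<chi> x)) (\<lambda>v. delta g \<star> v)
    = trace_on (left_ideal x) (\<lambda>v. cscale (\<chi> g) (delta g \<star> v))"
  proof (rule trace_on_transport[OF left_ideal_subspace left_ideal_fin clinear_twist])
    show "inj_on (twist \<chi>) (left_ideal x)"
      by (rule inj_on_inverseI[where g = "twist \<chi>"]) (simp add: tt left_ideal_in_alg)
    have "twist \<chi> ` alg = alg"
      using tt twist_in_alg by (metis (no_types, lifting) image_eqI image_subsetI subsetI subset_antisym)
    moreover have "twist \<chi> ` left_ideal x = (\<lambda>y. y \<star> twist \<chi> x) ` twist \<chi> ` alg"
      by (simp add: left_ideal_def image_image twist_conv[OF hom])
    ultimately show "twist \<chi> ` left_ideal x = left_ideal (twist \<chi> x)"
      by (simp add: left_ideal_def)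
    show "clinear (\<lambda>v. cscale (\<chi> g) (delta g \<star> v))"
      by (intro clinearI) (simp_all add: conv_add_right conv_cscale_right fs.scale_right_distrib mult.commute)
    show "(\<lambda>v. cscale (\<chi> g) (delta g \<star> v)) ` left_ideal x \<subseteq> left_ideal x"
      by (auto intro: fs.subspace_scale left_ideal_subspace left_ideal_closed)
    fix v
    show "twist \<chi> (cscale (\<chi> g) (delta g \<star> v)) = delta g \<star> twist \<chi> v"
      by (simp add: clinear_scale[OF clinear_twist] twist_conv[OF hom] td conv_cscale_left sq[OF g])
  qed (rule clinear_conv_left)
  also have "\<dots> = \<chi> g * trace_on (left_ideal x) (\<lambda>v. delta g \<star> v)"
    by (rule trace_on_scale[OF left_ideal_subspace left_ideal_fin])
      (auto intro: clinear_conv_left left_ideal_closed)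
  finally show ?thesis .
qed

end

section \<open>Transposition of Young diagrams\<close>

text \<open>
  The number of the box in row \<open>r\<close> and column \<open>c\<close>, inverse to the pair \<open>row_of\<close>, \<open>col_of\<close>.
\<close>

definition pos_of :: "nat list \<Rightarrow> nat \<Rightarrow> nat \<Rightarrow> nat" where
  "pos_of ms r c = sum_list (take r ms) + c"

lemma sum_list_take_mono: "r \<le> s \<Longrightarrow> sum_list (take r ms) \<le> sum_list (take s (ms :: nat list))"
  by (metis le_add1 le_iff_add sum_list_append take_add)

lemma sum_list_take_Suc: "r < length ms \<Longrightarrow> sum_list (take (Suc r) ms) = sum_list (take r ms) + (ms ! r :: nat)"
  by (simp add: take_Suc_conv_app_nth)

lemma row_of_pos_of:
  assumes "r < length ms" "1 \<le> c" "c \<le> ms ! r"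
  shows "row_of ms (pos_of ms r c) = r"
  unfolding row_of_def
proof (rule Least_equality)
  show "pos_of ms r c \<le> sum_list (take (Suc r) ms)"
    using assms by (simp only: pos_of_def sum_list_take_Suc)
  fix y assume "pos_of ms r c \<le> sum_list (take (Suc y) ms)"
  then show "r \<le> y"
    using assms(2) sum_list_take_mono[of "Suc y" r ms] by (cases "Suc y \<le> r") (auto simp: pos_of_def)
qed

lemma col_of_pos_of:
  assumes "r < length ms" "1 \<le> c" "c \<le> ms ! r"
  shows "col_of ms (pos_of ms r c) = c"
  unfolding col_of_def row_of_pos_of[OF assms] by (simp add: pos_of_def)

lemma pos_of_range:
  assumes "r < length ms" "1 \<le> c" "c \<le> ms ! r"
  shows "pos_of ms r c \<in> {1..sum_list ms}"
  using assms sum_list_take_mono[of "Suc r" "length ms" ms]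
  by (simp add: pos_of_def take_Suc_conv_app_nth)

lemma row_of_col_of_box:
  assumes k: "k \<in> {1..sum_list ms}"
  shows "row_of ms k < length ms" "1 \<le> col_of ms k" "col_of ms k \<le> ms ! row_of ms k"
    "pos_of ms (row_of ms k) (col_of ms k) = k"
proof -
  let ?P = "\<lambda>r. k \<le> sum_list (take (Suc r) ms)"
  have ne: "ms \<noteq> []" using k by auto
  then have P: "?P (length ms - 1)" using k by simp
  have Pr: "?P (row_of ms k)" unfolding row_of_def using P by (rule LeastI)
  have "row_of ms k \<le> length ms - 1" unfolding row_of_def using P by (rule Least_le)
  then show r: "row_of ms k < length ms" using ne by (cases ms) auto
  have lt: "sum_list (take (row_of ms k) ms) < k"
  proof (cases "row_of ms k")
    case 0
    then show ?thesis using k by simp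
  next
    case (Suc r')
    then have "\<not> ?P r'" unfolding row_of_def by (intro not_less_Least) simp
    then show ?thesis using Suc by simp
  qed
  show "1 \<le> col_of ms k" using lt by (simp add: col_of_def)
  show "col_of ms k \<le> ms ! row_of ms k"
    using Pr unfolding sum_list_take_Suc[OF r] by (simp add: col_of_def)
  show "pos_of ms (row_of ms k) (col_of ms k) = k"
    using lt by (simp add: pos_of_def col_of_def)
qed

lemma less_length_filter_iff:
  "sorted_wrt (\<ge>) ms \<Longrightarrow> i < length (filter (\<lambda>k. r < k) ms) \<longleftrightarrow> i < length ms \<and> r < (ms ! i :: nat)"
proof (induction ms arbitrary: i)
  case (Cons m ms)
  show ?case
  proof (cases "r < m")
    case True
    then show ?thesis using Cons by (cases i) auto
  next
    case False
    then have all: "\<forall>k\<in>set (m # ms). \<not> r < k" using Cons.prems by auto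
    then have "filter (\<lambda>k. r < k) (m # ms) = []" by simp
    then show ?thesis using all nth_mem[of i "m # ms"] by fastforce
  qed
qed simp

lemma conjugate_partition_box:
  assumes "sorted_wrt (\<ge>) ms"
  shows "r < length (conjugate_partition ms) \<and> c \<le> conjugate_partition ms ! r \<and> 1 \<le> c
    \<longleftrightarrow> c - 1 < length ms \<and> Suc r \<le> ms ! (c - 1) \<and> 1 \<le> c"
proof (cases ms)
  case (Cons m ms')
  have "r < m" if "c - 1 < length ms" "Suc r \<le> ms ! (c - 1)"
  proof -
    have "ms ! (c - 1) \<le> ms ! 0"
      using assms that by (cases "c - 1 = 0") (auto simp: sorted_wrt_iff_nth_less)
    then show ?thesis using that Cons by simp
  qed
  moreover have "c \<le> length (filter (\<lambda>k. r < k) ms) \<and> 1 \<le> c \<longleftrightarrow> c - 1 < length ms \<and> Suc r \<le> ms ! (c - 1) \<and> 1 \<le> c"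
    using less_length_filter_iff[OF assms, of "c - 1" r] by (cases c) auto
  ultimately show ?thesis unfolding Cons by auto
qed simp

text \<open>
  Reflecting the diagram at its diagonal sends the boxes of \<open>ms\<close> bijectively to the boxes of the
  conjugate partition; \<open>w\<close> is this reflection, read off in the two numberings of the boxes. The
  bijection also shows that both diagrams have the same size. The shifts by one come from counting
  rows from \<open>0\<close> and columns from \<open>1\<close>.
\<close>

lemma conjugate_partition_relabelling:
  assumes sorted: "sorted_wrt (\<ge>) ms"
  obtains w where "w permutes {1..sum_list ms}" "sum_list (conjugate_partition ms) = sum_list ms"
    "\<And>k. k \<in> {1..sum_list ms} \<Longrightarrow> row_of (conjugate_partition ms) (w k) = col_of ms k - 1"
    "\<And>k. k \<in> {1..sum_list ms} \<Longrightarrow> col_of (conjugate_partition ms) (w k) = Suc (row_of ms k)"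
proof -
  define cp where "cp = conjugate_partition ms"
  note box = conjugate_partition_box[OF sorted, folded cp_def]
  define w where "w k = (if k \<in> {1..sum_list ms} then pos_of cp (col_of ms k - 1) (Suc (row_of ms k)) else k)" for k
  define v where "v k = pos_of ms (col_of cp k - 1) (Suc (row_of cp k))" for k
  have b1: "col_of ms k - 1 < length cp" "1 \<le> Suc (row_of ms k)" "Suc (row_of ms k) \<le> cp ! (col_of ms k - 1)"
    if "k \<in> {1..sum_list ms}" for k
    using row_of_col_of_box[OF that] box[of "col_of ms k - 1" "Suc (row_of ms k)"] by auto
  have b2: "col_of cp k - 1 < length ms" "1 \<le> Suc (row_of cp k)" "Suc (row_of cp k) \<le> ms ! (col_of cp k - 1)"
    if "k \<in> {1..sum_list cp}" for k
    using row_of_col_of_box[OF that] box[of "row_of cp k" "col_of cp k"] by auto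
  have w: "w k \<in> {1..sum_list cp}" "row_of cp (w k) = col_of ms k - 1" "col_of cp (w k) = Suc (row_of ms k)"
    if "k \<in> {1..sum_list ms}" for k
    using that row_of_pos_of[OF b1[OF that]] col_of_pos_of[OF b1[OF that]] pos_of_range[OF b1[OF that]]
    by (simp_all add: w_def)
  have v: "v k \<in> {1..sum_list ms}" "row_of ms (v k) = col_of cp k - 1" "col_of ms (v k) = Suc (row_of cp k)"
    if "k \<in> {1..sum_list cp}" for k
    using row_of_pos_of[OF b2[OF that]] col_of_pos_of[OF b2[OF that]] pos_of_range[OF b2[OF that]]
    by (simp_all add: v_def)
  have bij: "bij_betw w {1..sum_list ms} {1..sum_list cp}"
  proof (rule bij_betw_byWitness[where f' = v])
    show "\<forall>k\<in>{1..sum_list ms}. v (w k) = k"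
    proof
      fix k assume k: "k \<in> {1..sum_list ms}"
      show "v (w k) = k"
        using row_of_col_of_box[OF k] by (simp add: v_def w[OF k])
    qed
    show "\<forall>k\<in>{1..sum_list cp}. w (v k) = k"
    proof
      fix k assume k: "k \<in> {1..sum_list cp}"
      show "w (v k) = k"
        using row_of_col_of_box[OF k] v(1)[OF k] by (simp add: w_def v(2,3)[OF k])
    qed
  qed (use w v in auto)
  have eq: "sum_list cp = sum_list ms" using bij_betw_same_card[OF bij] by simp
  have "w permutes {1..sum_list ms}"
    using bij unfolding eq by (rule bij_imp_permutes) (auto simp: w_def)
  then show ?thesis using that[of w] eq w unfolding cp_def by blast
qed

section \<open>The Specht character of the conjugate partition\<close>

lemma finite_group_sym: "finite_group (sym_group n)"
proof -
  have "finite (carrier (sym_group n))"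
    using finite_permutations[of "{1..n}"] by (simp add: sym_group_def)
  then show ?thesis
    using sym_group_is_group by (simp add: finite_group_def finite_group_axioms_def)
qed


text \<open>
  The two factors of the Young symmetrizer as explicit functions, so that identities between them can
  be checked one permutation at a time.
\<close>

definition row_sum :: "nat list \<Rightarrow> (nat \<Rightarrow> nat) \<Rightarrow> complex" where
  "row_sum ms = (\<lambda>p. if p \<in> row_stabilizer ms then 1 else 0)"

definition col_sum :: "nat list \<Rightarrow> (nat \<Rightarrow> nat) \<Rightarrow> complex" where
  "col_sum ms = (\<lambda>p. if p \<in> col_stabilizer ms then of_int (sign p) else 0)"

lemma sum_cscale_delta:
  assumes "finite A"
  shows "(\<Sum>p\<in>A. cscale (c p) (delta p)) = (\<lambda>p. if p \<in> A then c p else 0)"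
  using assms by induct (auto simp: fun_eq_iff cscale_def delta_def)

lemma young_symmetrizer_eq:
  "young_symmetrizer ms = row_sum ms \<otimes>\<^bsub>group_algebra (sym_group (sum_list ms))\<^esub> col_sum ms"
proof -
  have fin: "finite (row_stabilizer ms)" "finite (col_stabilizer ms)"
    using finite_group.finite_carrier[OF finite_group_sym[of "sum_list ms"]]
    by (auto simp: row_stabilizer_def col_stabilizer_def)
  have "(\<Sum>p\<in>row_stabilizer ms. delta p) = (\<Sum>p\<in>row_stabilizer ms. cscale 1 (delta p))"
    by simp
  then have "(\<Sum>p\<in>row_stabilizer ms. delta p) = row_sum ms"
    unfolding sum_cscale_delta[OF fin(1)] row_sum_def .
  moreover have "(\<Sum>q\<in>col_stabilizer ms. cscale (of_int (sign q)) (delta q)) = col_sum ms"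
    unfolding sum_cscale_delta[OF fin(2)] col_sum_def ..
  ultimately show ?thesis by (simp add: young_symmetrizer_def)
qed

lemma row_stabilizer_inv:
  assumes "p \<in> carrier (sym_group (sum_list ms))"
  shows "inv' p \<in> row_stabilizer ms \<longleftrightarrow> p \<in> row_stabilizer ms"
proof -
  have *: "inv' p \<in> row_stabilizer ms" if p: "p \<in> row_stabilizer ms" for p
  proof -
    have pp: "p permutes {1..sum_list ms}" using p by (simp add: row_stabilizer_def sym_group_carrier)
    have "row_of ms (inv' p k) = row_of ms k" if "k \<in> {1..sum_list ms}" for k
    proof -
      have "inv' p k \<in> {1..sum_list ms}" using permutes_in_image[OF permutes_inv[OF pp]] that by blast
      then have "row_of ms (p (inv' p k)) = row_of ms (inv' p k)"
        using p by (simp add: row_stabilizer_def)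
      then show ?thesis by (simp add: permutes_inverses(1)[OF pp])
    qed
    then show ?thesis using permutes_inv[OF pp] by (simp add: row_stabilizer_def sym_group_carrier)
  qed
  show ?thesis using *[of p] *[of "inv' p"] assms
    by (metis permutes_inv_inv sym_group_carrier)
qed

lemma col_stabilizer_inv:
  assumes "p \<in> carrier (sym_group (sum_list ms))"
  shows "inv' p \<in> col_stabilizer ms \<longleftrightarrow> p \<in> col_stabilizer ms"
proof -
  have *: "inv' p \<in> col_stabilizer ms" if p: "p \<in> col_stabilizer ms" for p
  proof -
    have pp: "p permutes {1..sum_list ms}" using p by (simp add: col_stabilizer_def sym_group_carrier)
    have "col_of ms (inv' p k) = col_of ms k" if "k \<in> {1..sum_list ms}" for k
    proof -
      have "inv' p k \<in> {1..sum_list ms}" using permutes_in_image[OF permutes_inv[OF pp]] that by blast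
      then have "col_of ms (p (inv' p k)) = col_of ms (inv' p k)"
        using p by (simp add: col_stabilizer_def)
      then show ?thesis by (simp add: permutes_inverses(1)[OF pp])
    qed
    then show ?thesis using permutes_inv[OF pp] by (simp add: col_stabilizer_def sym_group_carrier)
  qed
  show ?thesis using *[of p] *[of "inv' p"] assms
    by (metis permutes_inv_inv sym_group_carrier)
qed

lemma ball_permutes_reindex:
  assumes "w permutes A"
  shows "(\<forall>k\<in>A. P k) \<longleftrightarrow> (\<forall>k\<in>A. P (w k))"
  using permutes_image[OF assms] by (metis image_iff)

lemma sign_conj:
  assumes "permutation w" "permutation p"
  shows "sign (inv' w \<circ> p \<circ> w) = sign p"
  using assms by (simp add: sign_compose sign_inverse permutation_inverse permutation_compose sign_idempotent)

text \<open>
  With \<open>w\<close> the relabelling of the boxes, the row stabilizer of the conjugate partition is the conjugate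
  by \<open>w\<close> of the column stabilizer of \<open>ms\<close>, and vice versa. Therefore its Young symmetrizer is
  \<open>w \<cdot> twist (b a) \<cdot> w\<^sup>-\<^sup>1\<close>, where \<open>a b\<close> is the Young symmetrizer of \<open>ms\<close>. The factor \<open>w\<close> on the left does
  not change the left ideal, the factor \<open>w\<^sup>-\<^sup>1\<close> on the right gives an isomorphic one, the twist
  multiplies the trace by the sign, and \<open>b a\<close> is the adjoint of \<open>a b\<close>.
\<close>

lemma sym_character_conjugate:
  assumes part: "partition_of n ms" and p: "p permutes {1..n}"
  shows "sym_character (conjugate_partition ms) p = of_int (sign p) * sym_character ms p"
    and "sum_list (conjugate_partition ms) = n"
proof -
  define cp where "cp = conjugate_partition ms"
  have n: "sum_list ms = n" and sorted: "sorted_wrt (\<ge>) ms"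
    using part by (auto simp: partition_of_def)
  obtain w where w: "w permutes {1..n}" and cp: "sum_list cp = n"
    and rc: "\<And>k. k \<in> {1..n} \<Longrightarrow> row_of cp (w k) = col_of ms k - 1"
    and cr: "\<And>k. k \<in> {1..n} \<Longrightarrow> col_of cp (w k) = Suc (row_of ms k)"
    using conjugate_partition_relabelling[OF sorted] unfolding n cp_def by blast
  show "sum_list (conjugate_partition ms) = n" using cp by (simp add: cp_def)
  interpret S: finite_group "sym_group n" by (rule finite_group_sym)
  define sgn' :: "(nat \<Rightarrow> nat) \<Rightarrow> complex" where "sgn' = (\<lambda>p. of_int (sign p))"
  note perm = sym_group_carrier'[of _ n]
  have hom: "sgn' (x \<otimes>\<^bsub>sym_group n\<^esub> y) = sgn' x * sgn' y"
    if "x \<in> carrier (sym_group n)" "y \<in> carrier (sym_group n)" for x y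
    using that perm by (simp add: sgn'_def sym_group_mult sign_compose)
  have sq: "sgn' x * sgn' x = 1" for x
    by (simp add: sgn'_def sign_idempotent flip: of_int_mult)
  have wc: "w \<in> carrier (sym_group n)" using w by (simp add: sym_group_carrier)
  let ?a = "row_sum ms" and ?b = "col_sum ms"
  have ab_alg: "row_sum ls \<in> S.alg" "col_sum ls \<in> S.alg" if "sum_list ls = n" for ls
    using that by (auto simp: S.alg_iff row_sum_def col_sum_def row_stabilizer_def col_stabilizer_def)
  have adjoint: "S.adjoint ?a = ?a" "S.adjoint ?b = ?b"
  proof -
    show "S.adjoint ?a = ?a"
      using row_stabilizer_inv[of _ ms] ab_alg(1)[OF n] unfolding n
      by (intro S.alg_eqI S.adjoint_in_alg) (auto simp: S.adjoint_def row_sum_def)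
    show "S.adjoint ?b = ?b"
      using col_stabilizer_inv[of _ ms] ab_alg(2)[OF n] sign_inverse perm unfolding n
      by (intro S.alg_eqI S.adjoint_in_alg) (auto simp: S.adjoint_def col_sum_def)
  qed
  have conj: "(S.conv (S.conv (delta w) f) (delta (inv' w))) z = f (inv' w \<circ> z \<circ> w)"
    if "z \<in> carrier (sym_group n)" for f z
    using that wc by (simp add: S.conv_delta_apply S.delta_conv_apply sym_group_inv_closed sym_group_mult[of n]
        S.m_closed[of z w, unfolded sym_group_mult] permutes_inv_inv[OF w] o_assoc)
  have closed: "inv' w \<circ> z \<circ> w \<in> carrier (sym_group n)" if "z \<in> carrier (sym_group n)" for z
    using that w by (simp add: sym_group_carrier permutes_compose permutes_inv)
  have conj_pt: "inv' w (z (w k)) \<in> {1..n}" "w (inv' w (z (w k))) = z (w k)" "w k \<in> {1..n}"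
    if "z \<in> carrier (sym_group n)" "k \<in> {1..n}" for z k
    using that w by (auto simp: sym_group_carrier permutes_inverses permutes_in_image permutes_inv simp del: atLeastAtMost_iff)
  \<comment> \<open>Truncated subtraction in \<open>rc\<close> loses nothing, as columns are counted from \<open>1\<close>.\<close>
  have colpos: "1 \<le> col_of ms k" if "k \<in> {1..n}" for k
    using row_of_col_of_box(2)[of k ms] that n by simp
  have row_cp: "z \<in> row_stabilizer cp \<longleftrightarrow> inv' w \<circ> z \<circ> w \<in> col_stabilizer ms"
    if z: "z \<in> carrier (sym_group n)" for z
  proof -
    have "z \<in> row_stabilizer cp \<longleftrightarrow> (\<forall>k\<in>{1..n}. row_of cp (z (w k)) = row_of cp (w k))"
      unfolding row_stabilizer_def cp using z ball_permutes_reindex[OF w, of "\<lambda>k. row_of cp (z k) = row_of cp k"] by auto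
    also have "\<dots> \<longleftrightarrow> (\<forall>k\<in>{1..n}. col_of ms (inv' w (z (w k))) = col_of ms k)"
    proof (intro ball_cong refl)
      fix k assume k: "k \<in> {1..n}"
      show "(row_of cp (z (w k)) = row_of cp (w k)) = (col_of ms (inv' w (z (w k))) = col_of ms k)"
        using rc[OF k] rc[OF conj_pt(1)[OF z k]] colpos[OF k] colpos[OF conj_pt(1)[OF z k]]
        unfolding conj_pt(2)[OF z k] by auto
    qed
    finally show ?thesis using closed[OF z] by (simp add: col_stabilizer_def n)
  qed
  have col_cp: "z \<in> col_stabilizer cp \<longleftrightarrow> inv' w \<circ> z \<circ> w \<in> row_stabilizer ms"
    if z: "z \<in> carrier (sym_group n)" for z
  proof -
    have "z \<in> col_stabilizer cp \<longleftrightarrow> (\<forall>k\<in>{1..n}. col_of cp (z (w k)) = col_of cp (w k))"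
      unfolding col_stabilizer_def cp using z ball_permutes_reindex[OF w, of "\<lambda>k. col_of cp (z k) = col_of cp k"] by auto
    also have "\<dots> \<longleftrightarrow> (\<forall>k\<in>{1..n}. row_of ms (inv' w (z (w k))) = row_of ms k)"
    proof (intro ball_cong refl)
      fix k assume k: "k \<in> {1..n}"
      show "(col_of cp (z (w k)) = col_of cp (w k)) = (row_of ms (inv' w (z (w k))) = row_of ms k)"
        using cr[OF k] cr[OF conj_pt(1)[OF z k]]
        unfolding conj_pt(2)[OF z k] by auto
    qed
    finally show ?thesis using closed[OF z] by (simp add: row_stabilizer_def n)
  qed
  have sgn_conj: "sign (inv' w \<circ> z \<circ> w) = sign z" if "z \<in> carrier (sym_group n)" for z
    using sign_conj[OF perm[OF wc] perm[OF that]] .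
  have row_eq: "row_sum cp = S.conv (S.conv (delta w) (S.twist sgn' ?b)) (delta (inv' w))"
    using ab_alg(1)[OF cp] row_cp sgn_conj sign_idempotent
    by (intro S.alg_eqI) (auto simp: conj row_sum_def S.twist_def col_sum_def sgn'_def simp flip: of_int_mult)
  have col_eq: "col_sum cp = S.conv (S.conv (delta w) (S.twist sgn' ?a)) (delta (inv' w))"
    using ab_alg(2)[OF cp] col_cp sgn_conj
    by (intro S.alg_eqI) (auto simp: conj row_sum_def S.twist_def col_sum_def sgn'_def)
  have ww: "S.conv (delta (inv' w)) (delta w) = delta \<one>\<^bsub>sym_group n\<^esub>"
    using S.delta_conv_delta[of "inv' w" w] wc sym_group_inv_closed[OF wc] S.l_inv[OF wc] by simp
  \<comment> \<open>The two inner factors \<open>w\<^sup>-\<^sup>1\<close> and \<open>w\<close> of the conjugated sums cancel.\<close>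
  have "young_symmetrizer cp = S.conv (row_sum cp) (col_sum cp)"
    by (simp add: young_symmetrizer_eq cp)
  also have "\<dots> = S.conv (delta w) (S.conv (S.conv (S.twist sgn' ?b) (S.conv (S.conv (delta (inv' w)) (delta w)) (S.twist sgn' ?a))) (delta (inv' w)))"
    unfolding row_eq col_eq by (simp only: S.conv_assoc)
  also have "\<dots> = S.conv (delta w) (S.conv (S.twist sgn' (S.conv ?b ?a)) (delta (inv' w)))"
    unfolding ww using ab_alg[OF n] by (simp add: S.twist_in_alg S.twist_conv[OF hom])
  finally have c: "young_symmetrizer cp = \<dots>" .
  have id: "S.left_ideal (young_symmetrizer ls) = specht_module ls" if "sum_list ls = n" for ls
    by (simp add: S.left_ideal_def specht_module_def that Let_def)
  have "sym_character cp p = trace_on (S.left_ideal (young_symmetrizer cp)) (\<lambda>v. S.conv (delta p) v)"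
    unfolding sym_character_def id[OF cp] unfolding cp ..
  also have "\<dots> = trace_on (S.left_ideal (S.twist sgn' (S.conv ?b ?a))) (\<lambda>v. S.conv (delta p) v)"
    unfolding c S.left_ideal_delta_conv[OF wc]
    by (rule S.trace_left_ideal_conv_delta) (simp_all add: sym_group_inv_closed wc S.twist_in_alg)
  also have "\<dots> = sgn' p * trace_on (S.left_ideal (S.conv ?b ?a)) (\<lambda>v. S.conv (delta p) v)"
    by (rule S.trace_left_ideal_twist) (use hom sq p in \<open>auto simp: sym_group_carrier\<close>)
  also have "S.conv ?b ?a = S.adjoint (S.conv ?a ?b)"
    by (simp add: S.adjoint_conv adjoint)
  also have "trace_on (S.left_ideal (S.adjoint (S.conv ?a ?b))) (\<lambda>v. S.conv (delta p) v)
      = trace_on (S.left_ideal (S.conv ?a ?b)) (\<lambda>v. S.conv (delta p) v)"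
    by (rule S.trace_left_ideal_adjoint) simp
  also have "S.conv ?a ?b = young_symmetrizer ms"
    by (simp add: young_symmetrizer_eq n)
  also have "trace_on (S.left_ideal (young_symmetrizer ms)) (\<lambda>v. S.conv (delta p) v) = sym_character ms p"
    unfolding sym_character_def id[OF n] unfolding n ..
  finally show "sym_character (conjugate_partition ms) p = of_int (sign p) * sym_character ms p"
    by (simp add: cp_def sgn'_def)
qed

section \<open>Counting inversions inside a set\<close>

lemma permutes_adjacent_induct [consumes 1, case_names id adjacent]:
  assumes p: "p permutes {1..n}" and id: "P id"
    and step: "\<And>i p. i \<in> {1..<n} \<Longrightarrow> p permutes {1..n} \<Longrightarrow> P p \<Longrightarrow> P (Transposition.transpose i (Suc i) \<circ> p)"
  shows "P p"
  using p finite_atLeastAtMost[of 1 n]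
proof (induction rule: permutes_induct)
  case id
  show ?case by (rule assms(2))
next
  case (swap a b p)
  have adj: "P (apply_adj_transps xs \<circ> p)" if "set xs \<subseteq> {1..<n}" for xs
    using that
  proof (induction xs)
    case Nil
    then show ?case using swap.IH by simp
  next
    case (Cons x xs)
    have "apply_adj_transps xs permutes {1..n}"
      using Cons.prems by (intro permutes_apply_adj_transps) auto
    then have "apply_adj_transps xs \<circ> p permutes {1..n}"
      using swap.hyps by (simp add: permutes_compose)
    then have "P (Transposition.transpose x (Suc x) \<circ> (apply_adj_transps xs \<circ> p))"
      using Cons.prems by (intro step Cons.IH) auto
    then show ?case by (simp only: apply_adj_transps_Cons Suc_eq_plus1 o_assoc)
  qed
  have lt: "P (Transposition.transpose a b \<circ> p)" if "a < b" "a \<in> {1..n}" "b \<in> {1..n}" for a b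
    using adj[of "adj_transp_seq a b"] that
    by (simp add: adj_transp_seq_correct set_adj_transp_seq subset_iff)
  show ?case
  proof (cases "a < b")
    case True
    then show ?thesis using swap.hyps by (intro lt)
  next
    case False
    then have "P (Transposition.transpose b a \<circ> p)" using swap.hyps by (intro lt) auto
    then show ?thesis by (simp only: transpose_commute)
  qed
qed

text \<open>
  The sign is attached to unordered pairs, because a permutation maps pairs of elements of \<open>X\<close> to
  pairs of elements of its image without respecting their order.
\<close>

definition pair_sign :: "(nat \<Rightarrow> nat) \<Rightarrow> nat set \<Rightarrow> int" where
  "pair_sign p e = (if p (Min e) < p (Max e) then 1 else -1)"

definition inversion_sign :: "nat set \<Rightarrow> (nat \<Rightarrow> nat) \<Rightarrow> int" where
  "inversion_sign X p = (\<Prod>e | e \<subseteq> X \<and> card e = 2. pair_sign p e)"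

lemma pair_cases:
  assumes "e \<subseteq> X" "card e = 2"
  obtains i j where "e = {i, j}" "i < j" "i \<in> X" "j \<in> (X :: nat set)"
proof -
  obtain x y where xy: "e = {x, y}" "x \<noteq> y" using assms(2) card_2_iff by metis
  show ?thesis
  proof (cases "x < y")
    case True
    then show ?thesis using that[of x y] xy assms(1) by auto
  next
    case False
    then show ?thesis using that[of y x] xy assms(1) by auto
  qed
qed

lemma pair_sign_pair [simp]: "i < j \<Longrightarrow> pair_sign p {i, j} = (if p i < p j then 1 else -1)"
  by (simp add: pair_sign_def max_def min_def)

text \<open>
  The map \<open>p \<circ> q\<close> reverses the order of a pair iff exactly one of the two steps does.
\<close>

lemma pair_sign_comp:
  assumes "inj_on q X" "inj_on p (q ` X)" "e \<subseteq> X" "card e = 2"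
  shows "pair_sign (p \<circ> q) e = pair_sign p (q ` e) * pair_sign q e"
proof -
  obtain i j where e: "e = {i, j}" "i < j" "i \<in> X" "j \<in> X"
    using pair_cases[OF assms(3,4)] .
  have q: "q i \<noteq> q j" using e assms(1) by (auto dest: inj_onD)
  have p: "p (q i) \<noteq> p (q j)" using e assms(2) q by (auto dest: inj_onD)
  show ?thesis
  proof (cases "q i < q j")
    case True
    then show ?thesis using e by simp
  next
    case False
    then have "q j < q i" using q by simp
    then have "pair_sign p {q j, q i} = (if p (q j) < p (q i) then 1 else -1)" by simp
    then show ?thesis using e p False by (simp add: insert_commute)
  qed
qed

text \<open>
  The cocycle identity that makes the inversion sign define an automorphism of the group algebra.
\<close>

lemma inversion_sign_comp:
  assumes q: "inj_on q X" and p: "inj_on p (q ` X)"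
  shows "inversion_sign X (p \<circ> q) = inversion_sign (q ` X) p * inversion_sign X q"
proof -
  have bij: "bij_betw ((`) q) {e. e \<subseteq> X \<and> card e = 2} {e. e \<subseteq> q ` X \<and> card e = 2}"
  proof (rule bij_betw_imageI)
    show "inj_on ((`) q) {e. e \<subseteq> X \<and> card e = 2}"
      using q by (auto intro!: inj_onI simp: inj_on_image_eq_iff)
    show "(`) q ` {e. e \<subseteq> X \<and> card e = 2} = {e. e \<subseteq> q ` X \<and> card e = 2}"
    proof (intro equalityI subsetI)
      fix e assume "e \<in> {e. e \<subseteq> q ` X \<and> card e = 2}"
      then obtain d where d: "d \<subseteq> X" "e = q ` d" "card e = 2" by (auto simp: subset_image_iff)
      then show "e \<in> (`) q ` {e. e \<subseteq> X \<and> card e = 2}"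
        using card_image[OF inj_on_subset[OF q d(1)]] by auto
    next
      fix e assume "e \<in> (`) q ` {e. e \<subseteq> X \<and> card e = 2}"
      then show "e \<in> {e. e \<subseteq> q ` X \<and> card e = 2}"
        using card_image inj_on_subset[OF q] by fastforce
    qed
  qed
  have "inversion_sign X (p \<circ> q) = (\<Prod>e | e \<subseteq> X \<and> card e = 2. pair_sign p (q ` e) * pair_sign q e)"
    unfolding inversion_sign_def by (intro prod.cong refl pair_sign_comp[OF q p]) auto
  also have "\<dots> = (\<Prod>e | e \<subseteq> X \<and> card e = 2. pair_sign p (q ` e)) * inversion_sign X q"
    by (simp add: prod.distrib inversion_sign_def)
  also have "(\<Prod>e | e \<subseteq> X \<and> card e = 2. pair_sign p (q ` e)) = inversion_sign (q ` X) p"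
    unfolding inversion_sign_def by (rule prod.reindex_bij_betw[OF bij])
  finally show ?thesis .
qed

lemma inversion_sign_cong:
  assumes "\<And>k. k \<in> X \<Longrightarrow> p k = q k"
  shows "inversion_sign X p = inversion_sign X q"
  unfolding inversion_sign_def
proof (intro prod.cong refl)
  fix e assume "e \<in> {e. e \<subseteq> X \<and> card e = 2}"
  then obtain i j where "e = {i, j}" "i < j" "i \<in> X" "j \<in> X"
    by (auto elim: pair_cases)
  then show "pair_sign p e = pair_sign q e" using assms by simp
qed

lemma inversion_sign_mono:
  assumes "\<And>i j. i \<in> X \<Longrightarrow> j \<in> X \<Longrightarrow> i < j \<Longrightarrow> p i < p j"
  shows "inversion_sign X p = 1"
  unfolding inversion_sign_def
proof (intro prod.neutral ballI)
  fix e assume "e \<in> {e. e \<subseteq> X \<and> card e = 2}"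
  then obtain i j where "e = {i, j}" "i < j" "i \<in> X" "j \<in> X"
    by (auto elim: pair_cases)
  then show "pair_sign p e = 1" using assms by simp
qed

lemma inversion_sign_square: "inversion_sign X p * inversion_sign X p = 1"
  unfolding inversion_sign_def prod.distrib[symmetric]
  by (intro prod.neutral) (simp add: pair_sign_def)

lemma inversion_sign_adjacent:
  assumes "finite X"
  shows "inversion_sign X (Transposition.transpose i (Suc i)) = (if i \<in> X \<and> Suc i \<in> X then -1 else 1)"
proof -
  have fin: "finite {e. e \<subseteq> X \<and> card e = 2}" using assms by (auto intro: finite_subset[of _ "Pow X"])
  have "inversion_sign X (Transposition.transpose i (Suc i)) = (\<Prod>e | e \<subseteq> X \<and> card e = 2. if e = {i, Suc i} then -1 else 1)"
    unfolding inversion_sign_def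
  proof (intro prod.cong refl)
    fix e assume "e \<in> {e. e \<subseteq> X \<and> card e = 2}"
    then obtain j k where e: "e = {j, k}" "j < k"
      by (auto elim: pair_cases)
    then have "e = {i, Suc i} \<longleftrightarrow> j = i \<and> k = Suc i" by (auto simp: doubleton_eq_iff)
    then show "pair_sign (Transposition.transpose i (Suc i)) e = (if e = {i, Suc i} then -1 else 1)"
      using e by (auto simp: Transposition.transpose_def)
  qed
  also have "\<dots> = (if i \<in> X \<and> Suc i \<in> X then -1 else 1)"
    using fin by (simp add: prod.delta)
  finally show ?thesis .
qed

text \<open>
  For the full set the cocycle is a homomorphism with value \<open>-1\<close> at adjacent transpositions, which
  generate the group.
\<close>

lemma sign_eq_inversion_sign:
  assumes "p permutes {1..n}"
  shows "sign p = inversion_sign {1..n} p"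
  using assms
proof (induction rule: permutes_adjacent_induct)
  case id
  show ?case by (simp add: inversion_sign_mono)
next
  case (adjacent i p)
  have "permutation p" using adjacent.hyps(2) permutation_permutes by blast
  then have "sign (Transposition.transpose i (Suc i) \<circ> p) = - sign p"
    by (simp add: sign_compose permutation_swap_id sign_swap_id)
  moreover have "inversion_sign {1..n} (Transposition.transpose i (Suc i) \<circ> p) = - inversion_sign {1..n} p"
    using adjacent.hyps
    by (subst inversion_sign_comp) (auto simp: permutes_inj_on permutes_image inversion_sign_adjacent)
  ultimately show ?case by (simp only: adjacent.IH)
qed

section \<open>Characters of the diagonal subgroup\<close>

text \<open>
  A set \<open>Y\<close> stands for the diagonal matrix with entries \<open>-1\<close> at the positions in \<open>Y\<close>; multiplication
  of such matrices is symmetric difference. The set \<open>X\<close> stands for the linear character with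
  \<open>t\<^sub>i \<mapsto> -1\<close> iff \<open>i \<in> X\<close>.
\<close>

definition diag_char :: "nat set \<Rightarrow> nat set \<Rightarrow> complex" where
  "diag_char X Y = (\<Prod>i\<in>X. if i \<in> Y then -1 else 1)"

lemma diag_char_sym_diff: "diag_char Z (sym_diff X Y) = diag_char Z X * diag_char Z Y"
  unfolding diag_char_def prod.distrib[symmetric] by (intro prod.cong) auto

lemma diag_char_square: "diag_char Z X * diag_char Z X = 1"
  unfolding diag_char_def prod.distrib[symmetric] by (intro prod.neutral) auto

lemma diag_char_empty [simp]: "diag_char Z {} = 1"
  by (simp add: diag_char_def)

lemma diag_char_singleton: "finite Z \<Longrightarrow> diag_char Z {i} = (if i \<in> Z then -1 else 1)"
  by (simp add: diag_char_def)

lemma diag_char_image: "inj_on q Z \<Longrightarrow> diag_char (q ` Z) X = diag_char Z (q -` X)"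
  by (simp add: diag_char_def prod.reindex)

lemma diag_char_cong: "X \<inter> Z = Y \<inter> Z \<Longrightarrow> diag_char Z X = diag_char Z Y"
  unfolding diag_char_def by (intro prod.cong) auto

lemma diag_char_eq_power: "finite X \<Longrightarrow> diag_char X Y = (-1) ^ card (X \<inter> Y)"
  unfolding diag_char_def by (simp add: prod.If_cases)

lemma diag_char_commute: "finite X \<Longrightarrow> finite Y \<Longrightarrow> diag_char X Y = diag_char Y X"
  by (simp add: diag_char_eq_power Int_commute)

text \<open>
  The sum over all \<open>X\<close> is the expansion of a product whose factors at the elements of \<open>Y\<close> vanish.
\<close>

lemma sum_diag_char:
  assumes N: "finite N" and Y: "Y \<subseteq> N"
  shows "(\<Sum>X\<in>Pow N. diag_char X Y) = (if Y = {} then 2 ^ card N else 0)"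
proof -
  have "(\<Sum>X\<in>Pow N. diag_char X Y) = (\<Prod>i\<in>N. (if i \<in> Y then -1 else 1) + 1)"
    using prod_add[OF N, of "\<lambda>i. if i \<in> Y then -1 else 1 :: complex" "\<lambda>_. 1"] by (simp add: diag_char_def)
  also have "\<dots> = (if Y = {} then 2 ^ card N else 0)"
    using N Y by (auto simp: prod_zero_iff)
  finally show ?thesis .
qed

lemma diag_char_orthogonal:
  assumes N: "finite N" and Y: "Y \<subseteq> N" "Y' \<subseteq> N"
  shows "(\<Sum>X\<in>Pow N. diag_char X Y * diag_char X Y') = (if Y = Y' then 2 ^ card N else 0)"
proof -
  have "(\<Sum>X\<in>Pow N. diag_char X Y * diag_char X Y') = (\<Sum>X\<in>Pow N. diag_char X (sym_diff Y Y'))"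
    by (simp only: diag_char_sym_diff)
  also have "\<dots> = (if sym_diff Y Y' = {} then 2 ^ card N else 0)"
    using Y by (intro sum_diag_char[OF N]) auto
  finally show ?thesis by auto
qed

section \<open>Signed permutation matrices\<close>

text \<open>
  The product of the permutation matrix of \<open>p\<close> and the diagonal matrix of \<open>X\<close>, that is, \<open>X\<close> lists the
  columns whose non-zero entry is \<open>-1\<close>. Permutations and columns are numbered from \<open>1\<close>, matrix entries
  from \<open>0\<close>.
\<close>

definition smat :: "nat \<Rightarrow> (nat \<Rightarrow> nat) \<Rightarrow> nat set \<Rightarrow> int mat" where
  "smat n p X = mat n n (\<lambda>(i, j). if Suc i = p (Suc j) then (if Suc j \<in> X then -1 else 1) else 0)"

lemma smat_carrier_mat [simp]: "smat n p X \<in> carrier_mat n n"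
  and dim_smat [simp]: "dim_row (smat n p X) = n" "dim_col (smat n p X) = n"
  by (simp_all add: smat_def)

lemma smat_index [simp]:
  "i < n \<Longrightarrow> j < n \<Longrightarrow> smat n p X $$ (i, j) = (if Suc i = p (Suc j) then (if Suc j \<in> X then -1 else 1) else 0)"
  by (simp add: smat_def)

lemma smat_cong:
  assumes "\<And>k. k \<in> {1..n} \<Longrightarrow> p k = q k" "X \<inter> {1..n} = Y \<inter> {1..n}"
  shows "smat n p X = smat n q Y"
proof (rule eq_matI)
  fix i j assume "i < dim_row (smat n q Y)" "j < dim_col (smat n q Y)"
  then have ij: "i < n" "j < n" by auto
  have "Suc j \<in> X \<inter> {1..n} \<longleftrightarrow> Suc j \<in> Y \<inter> {1..n}" by (simp only: assms(2))
  then have "Suc j \<in> X \<longleftrightarrow> Suc j \<in> Y" using ij by simp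
  then show "smat n p X $$ (i, j) = smat n q Y $$ (i, j)" using ij assms(1)[of "Suc j"] by simp
qed auto

lemma smat_index_pred:
  assumes "i \<in> {1..n}" "k \<in> {1..n}"
  shows "smat n p X $$ (i - 1, k - 1) = (if i = p k then (if k \<in> X then -1 else 1) else 0)"
  using assms by (cases i; cases k) auto

lemma permutes_Suc_range:
  assumes "p permutes {1..n}" "k < n"
  obtains m where "m < n" "p (Suc k) = Suc m"
proof -
  have "p (Suc k) \<in> {1..n}" using assms permutes_in_image[OF assms(1), of "Suc k"] by simp
  then show ?thesis using that[of "p (Suc k) - 1"] by auto
qed

lemma B_group_simps [simp]: "mult (B_group n) = (*)" "one (B_group n) = 1\<^sub>m n"
  by (simp_all add: B_group_def)

lemma smat_in_B_group:
  assumes p: "p permutes {1..n}"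
  shows "smat n p X \<in> carrier (B_group n)"
proof -
  have nz: "smat n p X $$ (i, j) \<noteq> 0 \<longleftrightarrow> Suc i = p (Suc j)" if "i < n" "j < n" for i j
    using that by simp
  have "\<exists>!j. j < n \<and> smat n p X $$ (i, j) \<noteq> 0" if i: "i < n" for i
  proof -
    obtain m where m: "m < n" "inv' p (Suc i) = Suc m"
      using permutes_Suc_range[OF permutes_inv[OF p] i] .
    have "Suc i = p (Suc j) \<longleftrightarrow> j = m" for j
      using m(2) permutes_inv_eq[OF p, of "Suc i" "Suc j"] by auto
    then show ?thesis using m(1) i nz by (metis (no_types, lifting))
  qed
  moreover have "\<exists>!i. i < n \<and> smat n p X $$ (i, j) \<noteq> 0" if j: "j < n" for j
  proof -
    obtain m where "m < n" "p (Suc j) = Suc m"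
      using permutes_Suc_range[OF p j] .
    then show ?thesis using nz[OF _ j] by (metis nat.inject)
  qed
  moreover have "\<forall>i<n. \<forall>j<n. smat n p X $$ (i, j) \<noteq> 0 \<longrightarrow> smat n p X $$ (i, j) \<in> {1, -1}"
    by simp
  ultimately show ?thesis by (simp only: B_group_def) (simp del: smat_index)
qed

text \<open>
  The permutation maps a column to the row of its non-zero entry; it is injective because a row has
  only one such entry.
\<close>

lemma B_group_eq_smat:
  assumes A: "A \<in> carrier (B_group n)"
  obtains p X where "p permutes {1..n}" "X \<subseteq> {1..n}" "A = smat n p X"
proof -
  have dim: "A \<in> carrier_mat n n"
    and row: "\<And>i. i < n \<Longrightarrow> \<exists>!j. j < n \<and> A $$ (i, j) \<noteq> 0"
    and col: "\<And>j. j < n \<Longrightarrow> \<exists>!i. i < n \<and> A $$ (i, j) \<noteq> 0"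
    and val: "\<And>i j. i < n \<Longrightarrow> j < n \<Longrightarrow> A $$ (i, j) \<noteq> 0 \<Longrightarrow> A $$ (i, j) \<in> {1, -1}"
    using A by (auto simp: B_group_def)
  define r where "r j = (THE i. i < n \<and> A $$ (i, j) \<noteq> 0)" for j
  have r: "r j < n" "A $$ (r j, j) \<noteq> 0" if "j < n" for j
    using theI'[OF col[OF that]] by (auto simp: r_def)
  have r_eq: "i = r j" if "i < n" "j < n" "A $$ (i, j) \<noteq> 0" for i j
    using the1_equality[OF col[OF that(2)], of i] that by (simp add: r_def)
  define p where "p k = (if k \<in> {1..n} then Suc (r (k - 1)) else k)" for k
  define X where "X = {k \<in> {1..n}. A $$ (r (k - 1), k - 1) = -1}"
  have inj: "inj_on p {1..n}"
  proof (rule inj_onI)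
    fix k l assume kl: "k \<in> {1..n}" "l \<in> {1..n}" "p k = p l"
    then have "r (k - 1) = r (l - 1)" by (simp add: p_def)
    moreover have "k - 1 < n" "l - 1 < n" using kl by auto
    ultimately have "k - 1 = l - 1"
      using row[OF r(1)[of "k - 1"]] r[of "k - 1"] r[of "l - 1"] by metis
    then show "k = l" using kl by auto
  qed
  have sub: "p ` {1..n} \<subseteq> {1..n}"
    using r(1) by (auto simp: p_def less_Suc_eq_le Suc_le_eq)
  have "p permutes {1..n}"
    using inj endo_inj_surj[OF finite_atLeastAtMost sub inj]
    by (intro bij_imp_permutes bij_betw_imageI) (auto simp: p_def)
  moreover have "X \<subseteq> {1..n}" by (auto simp: X_def)
  moreover have "A = smat n p X"
  proof (rule eq_matI)
    fix i j assume "i < dim_row (smat n p X)" "j < dim_col (smat n p X)"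
    then have ij: "i < n" "j < n" by auto
    show "A $$ (i, j) = smat n p X $$ (i, j)"
    proof (cases "i = r j")
      case True
      then show ?thesis using ij val[OF ij] r(2)[OF ij(2)] by (auto simp: p_def X_def)
    next
      case False
      then have "A $$ (i, j) = 0" using r_eq[OF ij] by blast
      then show ?thesis using ij False by (simp add: p_def)
    qed
  qed (use dim in auto)
  ultimately show ?thesis using that by blast
qed

lemma smat_inject:
  assumes p: "p permutes {1..n}" and q: "q permutes {1..n}"
    and X: "X \<subseteq> {1..n}" and Y: "Y \<subseteq> {1..n}" and eq: "smat n p X = smat n q Y"
  shows "p = q \<and> X = Y"
proof -
  have *: "p (Suc j) = q (Suc j) \<and> (Suc j \<in> X \<longleftrightarrow> Suc j \<in> Y)" if j: "j < n" for j
  proof -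
    obtain m where m: "m < n" "p (Suc j) = Suc m" using permutes_Suc_range[OF p j] .
    have "smat n p X $$ (m, j) = smat n q Y $$ (m, j)" using eq by simp
    then show ?thesis using m j by (auto split: if_splits)
  qed
  have k: "p k = q k \<and> (k \<in> X \<longleftrightarrow> k \<in> Y)" for k
  proof (cases "k \<in> {1..n}")
    case True
    then show ?thesis using *[of "k - 1"] by auto
  next
    case False
    then show ?thesis using p q X Y permutes_not_in by (metis subsetD)
  qed
  then show ?thesis by auto
qed

lemma smat_mult:
  assumes q: "q permutes {1..n}"
  shows "smat n p X * smat n q Y = smat n (p \<circ> q) (sym_diff (q -` X) Y)"
proof (rule eq_matI)
  fix i j assume "i < dim_row (smat n (p \<circ> q) (sym_diff (q -` X) Y))" "j < dim_col (smat n (p \<circ> q) (sym_diff (q -` X) Y))"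
  then have ij: "i < n" "j < n" by auto
  obtain m where m: "m < n" "q (Suc j) = Suc m" using permutes_Suc_range[OF q ij(2)] .
  have "(smat n p X * smat n q Y) $$ (i, j) = (\<Sum>k = 0..<n. smat n p X $$ (i, k) * smat n q Y $$ (k, j))"
    using ij by (simp add: times_mat_def scalar_prod_def)
  also have "\<dots> = (\<Sum>k = 0..<n. if k = m then smat n p X $$ (i, m) * smat n q Y $$ (m, j) else 0)"
    using ij m by (intro sum.cong refl) auto
  also have "\<dots> = smat n (p \<circ> q) (sym_diff (q -` X) Y) $$ (i, j)"
    using ij m by simp
  finally show "(smat n p X * smat n q Y) $$ (i, j) = smat n (p \<circ> q) (sym_diff (q -` X) Y) $$ (i, j)" .
qed auto

lemma smat_id: "smat n id {} = 1\<^sub>m n"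
  by (rule eq_matI) auto

lemma t_gen_eq_smat: "t_gen n i = smat n id {i}"
  by (rule eq_matI) (auto simp: t_gen_def)

lemma s_gen_eq_smat: "s_gen n i = smat n (Transposition.transpose i (Suc i)) {}"
  by (rule eq_matI) (auto simp: s_gen_def)

lemma s_gen_in_B_group: "i \<in> {1..<n} \<Longrightarrow> s_gen n i \<in> carrier (B_group n)"
  unfolding s_gen_eq_smat by (rule smat_in_B_group, rule permutes_swap_id) auto

lemma t_gen_in_B_group: "t_gen n i \<in> carrier (B_group n)"
  unfolding t_gen_eq_smat by (rule smat_in_B_group, rule permutes_id)

lemma smat_left_inverse:
  assumes "p permutes {1..n}"
  shows "smat n (inv' p) (p ` X) * smat n p X = 1\<^sub>m n"
  using assms by (simp add: smat_mult permutes_inv_o inj_vimage_image_eq permutes_inj smat_id)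

lemma finite_group_B: "finite_group (B_group n)"
proof -
  have "group (B_group n)"
  proof (rule groupI)
    fix x y z assume "x \<in> carrier (B_group n)" "y \<in> carrier (B_group n)" "z \<in> carrier (B_group n)"
    then have "x \<in> carrier_mat n n" "y \<in> carrier_mat n n" "z \<in> carrier_mat n n"
      by (auto simp: B_group_def)
    then show "x \<otimes>\<^bsub>B_group n\<^esub> y \<otimes>\<^bsub>B_group n\<^esub> z = x \<otimes>\<^bsub>B_group n\<^esub> (y \<otimes>\<^bsub>B_group n\<^esub> z)"
      by simp
  next
    fix x y assume "x \<in> carrier (B_group n)" "y \<in> carrier (B_group n)"
    then show "x \<otimes>\<^bsub>B_group n\<^esub> y \<in> carrier (B_group n)"
      by (elim B_group_eq_smat) (auto simp: smat_mult permutes_compose intro!: smat_in_B_group)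
  next
    fix x assume x: "x \<in> carrier (B_group n)"
    then have "x \<in> carrier_mat n n" by (auto simp: B_group_def)
    then show "\<one>\<^bsub>B_group n\<^esub> \<otimes>\<^bsub>B_group n\<^esub> x = x" by simp
    obtain p X where p: "p permutes {1..n}" "x = smat n p X" using x by (rule B_group_eq_smat)
    then have "smat n (inv' p) (p ` X) \<in> carrier (B_group n)" by (simp add: smat_in_B_group permutes_inv)
    then show "\<exists>y\<in>carrier (B_group n). y \<otimes>\<^bsub>B_group n\<^esub> x = \<one>\<^bsub>B_group n\<^esub>"
      using smat_left_inverse[OF p(1), of X] p(2) by auto
  next
    show "\<one>\<^bsub>B_group n\<^esub> \<in> carrier (B_group n)"
      using smat_in_B_group[OF permutes_id, of n "{}"] by (simp add: smat_id)
  qed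
  moreover have "carrier (B_group n) \<subseteq> (\<lambda>(p, X). smat n p X) ` ({p. p permutes {1..n}} \<times> Pow {1..n})"
    by (auto elim!: B_group_eq_smat)
  then have "finite (carrier (B_group n))"
    by (rule finite_subset) (simp add: finite_permutations)
  ultimately show ?thesis by (simp add: finite_group_def finite_group_axioms_def)
qed

lemma sum_B_group:
  "(\<Sum>A\<in>carrier (B_group n). F A) = (\<Sum>p | p permutes {1..n}. \<Sum>X\<in>Pow {1..n}. F (smat n p X))"
proof -
  have "bij_betw (\<lambda>(p, X). smat n p X) ({p. p permutes {1..n}} \<times> Pow {1..n}) (carrier (B_group n))"
  proof (rule bij_betw_imageI)
    show "inj_on (\<lambda>(p, X). smat n p X) ({p. p permutes {1..n}} \<times> Pow {1..n})"
      by (rule inj_onI) (clarify, drule smat_inject[rotated 4], blast+)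
    show "(\<lambda>(p, X). smat n p X) ` ({p. p permutes {1..n}} \<times> Pow {1..n}) = carrier (B_group n)"
    proof (intro equalityI subsetI)
      fix A assume "A \<in> carrier (B_group n)"
      then obtain p X where "p permutes {1..n}" "X \<subseteq> {1..n}" "A = smat n p X"
        by (rule B_group_eq_smat)
      then show "A \<in> (\<lambda>(p, X). smat n p X) ` ({p. p permutes {1..n}} \<times> Pow {1..n})"
        by blast
    qed (auto intro: smat_in_B_group[unfolded One_nat_def])
  qed
  from sum.reindex_bij_betw[OF this, of F] show ?thesis
    by (simp add: sum.cartesian_product case_prod_unfold)
qed

text \<open>
  The group is generated by the \<open>s_gen n i\<close> and \<open>t_gen n i\<close>. Adjacent transpositions produce every
  permutation matrix; since \<open>t_gen n (p k) * smat n p X\<close> flips the sign of column \<open>k\<close>, the signs can then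
  be inserted one at a time.
\<close>

lemma B_group_induct [consumes 1, case_names one t s]:
  assumes A: "A \<in> carrier (B_group n)" and one: "P (1\<^sub>m n)"
    and t: "\<And>i A. i \<in> {1..n} \<Longrightarrow> A \<in> carrier (B_group n) \<Longrightarrow> P A \<Longrightarrow> P (t_gen n i * A)"
    and s: "\<And>i A. i \<in> {1..<n} \<Longrightarrow> A \<in> carrier (B_group n) \<Longrightarrow> P A \<Longrightarrow> P (s_gen n i * A)"
  shows "P A"
proof -
  obtain p X where p: "p permutes {1..n}" and X: "X \<subseteq> {1..n}" and Aeq: "A = smat n p X"
    using A by (rule B_group_eq_smat)
  have base: "P (smat n p {})"
    using p
  proof (induction rule: permutes_adjacent_induct)
    case id
    then show ?case using one by (simp only: smat_id)
  next
    case (adjacent i p)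
    then have "P (s_gen n i * smat n p {})" by (intro s smat_in_B_group)
    moreover have "s_gen n i * smat n p {} = smat n (Transposition.transpose i (Suc i) \<circ> p) {}"
      using adjacent.hyps by (simp add: s_gen_eq_smat smat_mult)
    ultimately show ?case by (simp only:)
  qed
  have "finite X" using X finite_subset by blast
  then have "P (smat n p X)" using X
  proof induction
    case empty
    show ?case by (rule base)
  next
    case (insert k X)
    have pk: "p k \<in> {1..n}" using insert.prems permutes_in_image[OF p] by simp
    have "P (t_gen n (p k) * smat n p X)"
      using insert pk p by (intro t smat_in_B_group) auto
    moreover have "p -` {p k} = {k}" using permutes_inj[OF p] by (auto dest: injD)
    then have "t_gen n (p k) * smat n p X = smat n p (insert k X)"
      using insert.hyps p by (simp add: t_gen_eq_smat smat_mult)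
    ultimately show ?case by simp
  qed
  then show ?thesis by (simp add: Aeq)
qed

lemma B_proj_smat [simp]:
  assumes p: "p permutes {1..n}"
  shows "B_proj n (smat n p X) = p"
  unfolding B_proj_def
proof (rule the_equality)
  show "p \<in> carrier (sym_group n) \<and> (\<forall>j\<in>{1..n}. smat n p X $$ (p j - 1, j - 1) \<noteq> 0)"
  proof (intro conjI ballI)
    fix j assume j: "j \<in> {1..n}"
    then have "p j \<in> {1..n}" using permutes_in_image[OF p] by blast
    then show "smat n p X $$ (p j - 1, j - 1) \<noteq> 0" using j by (subst smat_index_pred) auto
  qed (use p in \<open>simp add: sym_group_carrier\<close>)
next
  fix q assume q: "q \<in> carrier (sym_group n) \<and> (\<forall>j\<in>{1..n}. smat n p X $$ (q j - 1, j - 1) \<noteq> 0)"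
  then have qp: "q permutes {1..n}" by (simp add: sym_group_carrier)
  show "q = p"
  proof
    fix k show "q k = p k"
    proof (cases "k \<in> {1..n}")
      case True
      then have "q k \<in> {1..n}" using permutes_in_image[OF qp] by blast
      then have "smat n p X $$ (q k - 1, k - 1) \<noteq> 0 \<longrightarrow> q k = p k"
        using True by (subst smat_index_pred) auto
      then show ?thesis using q True by blast
    next
      case False
      then show ?thesis using p qp permutes_not_in by metis
    qed
  qed
qed

definition neg_cols :: "nat \<Rightarrow> int mat \<Rightarrow> nat set" where
  "neg_cols n A = {k \<in> {1..n}. A $$ (B_proj n A k - 1, k - 1) = -1}"

lemma neg_cols_smat [simp]:
  assumes p: "p permutes {1..n}" and X: "X \<subseteq> {1..n}"
  shows "neg_cols n (smat n p X) = X"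
proof -
  have "smat n p X $$ (p k - 1, k - 1) = (if k \<in> X then -1 else 1)" if k: "k \<in> {1..n}" for k
  proof -
    have "p k \<in> {1..n}" using k permutes_in_image[OF p] by blast
    then show ?thesis using k by (subst smat_index_pred) auto
  qed
  then have "neg_cols n (smat n p X) = {k \<in> {1..n}. (if k \<in> X then -1 else 1 :: int) = -1}"
    unfolding neg_cols_def B_proj_smat[OF p] by (intro Collect_cong conj_cong refl) simp
  then show ?thesis using X by auto
qed

text \<open>
  The product of the signs of all columns is a linear character with the prescribed values on the
  generators, and it is the only one because the generators generate the group.
\<close>

lemma eps'_smat:
  assumes p: "p permutes {1..n}" and X: "X \<subseteq> {1..n}"
  shows "eps' n (smat n p X) = diag_char {1..n} X"
proof -
  define f where "f = restrict (\<lambda>A. diag_char {1..n} (neg_cols n A)) (carrier (B_group n))"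
  have f: "f (smat n p X) = diag_char {1..n} X" if "p permutes {1..n}" "X \<subseteq> {1..n}" for p X
    using that by (simp add: f_def smat_in_B_group)
  have mult: "f (A * B) = f A * f B" if AB: "A \<in> carrier (B_group n)" "B \<in> carrier (B_group n)" for A B
  proof -
    obtain p X where A: "p permutes {1..n}" "X \<subseteq> {1..n}" "A = smat n p X"
      using AB(1) by (rule B_group_eq_smat)
    obtain q Y where B: "q permutes {1..n}" "Y \<subseteq> {1..n}" "B = smat n q Y"
      using AB(2) by (rule B_group_eq_smat)
    have "q -` X \<subseteq> {1..n}" using A(2) permutes_in_image[OF B(1)] by blast
    moreover have "diag_char {1..n} (q -` X) = diag_char {1..n} X"
      using diag_char_image[OF permutes_inj_on[OF B(1)], of "{1..n}" X] permutes_image[OF B(1)] by simp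
    ultimately show ?thesis
      using A B by (subst A(3), subst B(3)) (simp add: smat_mult f permutes_compose le_supI1 diag_char_sym_diff Diff_subset_conv le_supI2)
  qed
  have ft: "f (t_gen n i) = -1" if "i \<in> {1..n}" for i
    using that f[OF permutes_id, of "{i}"] by (simp add: t_gen_eq_smat diag_char_singleton)
  have fs: "f (s_gen n i) = 1" if "i \<in> {1..<n}" for i
    using that f[OF permutes_swap_id, of i "Suc i" "{}"] by (simp add: s_gen_eq_smat)
  have "eps' n = f"
    unfolding eps'_def
  proof (rule the_equality)
    show "f \<in> extensional (carrier (B_group n)) \<and> (\<forall>A\<in>carrier (B_group n). f A \<noteq> 0) \<and>
      (\<forall>A\<in>carrier (B_group n). \<forall>B\<in>carrier (B_group n). f (A * B) = f A * f B) \<and>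
      (\<forall>i\<in>{1..n}. f (t_gen n i) = -1) \<and> (\<forall>i\<in>{1..<n}. f (s_gen n i) = 1)"
    proof (intro conjI ballI)
      show "f \<in> extensional (carrier (B_group n))" by (simp add: f_def)
      show "f A \<noteq> 0" if "A \<in> carrier (B_group n)" for A
        using that diag_char_square[of "{1..n}" "neg_cols n A"] by (auto simp: f_def)
    qed (rule mult ft fs, assumption+)+
  next
    fix g :: "int mat \<Rightarrow> complex" assume g: "g \<in> extensional (carrier (B_group n)) \<and> (\<forall>A\<in>carrier (B_group n). g A \<noteq> 0) \<and>
      (\<forall>A\<in>carrier (B_group n). \<forall>B\<in>carrier (B_group n). g (A * B) = g A * g B) \<and>
      (\<forall>i\<in>{1..n}. g (t_gen n i) = -1) \<and> (\<forall>i\<in>{1..<n}. g (s_gen n i) = 1)"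
    have oneB: "1\<^sub>m n \<in> carrier (B_group n)"
      using smat_in_B_group[OF permutes_id, of n "{}"] by (simp add: smat_id)
    have eq: "g A = f A" if "A \<in> carrier (B_group n)" for A
      using that
    proof (induction rule: B_group_induct)
      case one
      have "g (1\<^sub>m n * 1\<^sub>m n) = g (1\<^sub>m n) * g (1\<^sub>m n)" "g (1\<^sub>m n) \<noteq> 0" using g oneB by blast+
      moreover have "f (1\<^sub>m n) = 1" using f[OF permutes_id, of "{}"] by (simp add: smat_id)
      ultimately show ?case by simp
    next
      case (t i A)
      then show ?case using g t_gen_in_B_group mult[OF t_gen_in_B_group, of A i] ft by simp
    next
      case (s i A)
      then show ?case using g s_gen_in_B_group mult[OF s_gen_in_B_group, of i A] fs by simp
    qed
    show "g = f"
      using g by (intro extensionalityI[of g "carrier (B_group n)" f]) (auto simp: eq f_def)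
  qed
  then show ?thesis using f[OF p X] by simp
qed

section \<open>The automorphism in the basis of idempotents\<close>

interpretation B: finite_group "B_group n" for n
  by (rule finite_group_B)

text \<open>
  The coefficient of \<open>f\<close> at the basis element \<open>p e\<^sub>X\<close>, where \<open>e\<^sub>X\<close> is the idempotent of the diagonal
  subgroup that belongs to the character \<open>X\<close>.
\<close>

definition fourier :: "nat \<Rightarrow> (int mat \<Rightarrow> complex) \<Rightarrow> (nat \<Rightarrow> nat) \<Rightarrow> nat set \<Rightarrow> complex" where
  "fourier n f p X = (\<Sum>Y\<in>Pow {1..n}. diag_char X Y * f (smat n p Y))"

lemma fourier_add: "fourier n (f + g) p X = fourier n f p X + fourier n g p X"
  by (simp add: fourier_def algebra_simps sum.distrib)

lemma fourier_diff: "fourier n (f - g) p X = fourier n f p X - fourier n g p X"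
  by (simp add: fourier_def algebra_simps sum_subtractf)

lemma fourier_cscale: "fourier n (cscale c f) p X = c * fourier n f p X"
  by (simp add: fourier_def cscale_def sum_distrib_left algebra_simps)

lemma fourier_delta:
  assumes p: "p permutes {1..n}" and q: "q permutes {1..n}" and Y: "Y \<subseteq> {1..n}"
  shows "fourier n (delta (smat n p Y)) q X = (if p = q then diag_char X Y else 0)"
proof -
  have "fourier n (delta (smat n p Y)) q X = (\<Sum>Z\<in>Pow {1..n}. if Z = Y then (if p = q then diag_char X Y else 0) else 0)"
    unfolding fourier_def
  proof (intro sum.cong refl)
    fix Z assume "Z \<in> Pow {1..n}"
    then have "smat n q Z = smat n p Y \<longleftrightarrow> q = p \<and> Z = Y"
      using smat_inject[OF q p _ Y, of Z] by auto
    then show "diag_char X Z * delta (smat n p Y) (smat n q Z) = (if Z = Y then if p = q then diag_char X Y else 0 else 0)"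
      by (auto simp: delta_def)
  qed
  also have "\<dots> = (if p = q then diag_char X Y else 0)"
    using Y by simp
  finally show ?thesis .
qed

lemma linear_extension_B_group:
  "linear_extension (B_group n) \<phi> f = (\<Sum>p | p permutes {1..n}. \<Sum>Y\<in>Pow {1..n}. f (smat n p Y) * \<phi> (smat n p Y))"
  by (simp only: linear_extension_def sum_B_group)

lemma fourier_eq_linear_extension:
  assumes p: "p permutes {1..n}"
  shows "fourier n f p X = linear_extension (B_group n) (\<lambda>A. if B_proj n A = p then diag_char X (neg_cols n A) else 0) f"
proof -
  have "linear_extension (B_group n) (\<lambda>A. if B_proj n A = p then diag_char X (neg_cols n A) else 0) f
    = (\<Sum>q | q permutes {1..n}. if q = p then fourier n f p X else 0)"
    unfolding linear_extension_B_group fourier_def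
    by (intro sum.cong refl) (auto simp: B_proj_smat[unfolded One_nat_def] neg_cols_smat[unfolded One_nat_def] mult.commute intro!: sum.cong)
  also have "\<dots> = fourier n f p X"
    using p by (simp add: finite_permutations)
  finally show ?thesis ..
qed

text \<open>
  In the idempotent basis \<open>p e\<^sub>X \<cdot> q e\<^sub>Z\<close> is \<open>p q e\<^sub>Z\<close> if \<open>X = q Z\<close> and zero otherwise, because
  \<open>e\<^sub>X q = q e\<^sub>Y\<close> with \<open>Y\<close> the preimage of \<open>X\<close> under \<open>q\<close>.
\<close>

lemma fourier_conv:
  assumes r: "r permutes {1..n}"
  shows "fourier n (B.conv n f g) r Z = (\<Sum>p | p permutes {1..n}. \<Sum>q | q permutes {1..n}.
    if p \<circ> q = r then fourier n f p (q ` Z) * fourier n g q Z else 0)"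
proof -
  let ?S = "{p. p permutes {1..n}}" and ?N = "Pow {1..n}"
  let ?\<phi> = "\<lambda>A. if B_proj n A = r then diag_char Z (neg_cols n A) else 0"
  have \<phi>: "?\<phi> (smat n p X * smat n q Y) = (if p \<circ> q = r then diag_char (q ` Z) X * diag_char Z Y else 0)"
    if "p \<in> ?S" "q \<in> ?S" "X \<in> ?N" "Y \<in> ?N" for p q X Y
  proof -
    have pq: "p \<circ> q permutes {1..n}" using that permutes_compose by blast
    have "q -` X \<subseteq> {1..n}" using that permutes_in_image[of q "{1..n}"] by blast
    then have XY: "sym_diff (q -` X) Y \<subseteq> {1..n}" using that by blast
    have q: "q permutes {1..n}" using that by simp
    have "inj_on q Z" using permutes_inj_on[OF q] .
    then show ?thesis
      unfolding smat_mult[OF q] B_proj_smat[OF pq] neg_cols_smat[OF pq XY] diag_char_sym_diff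
      by (simp add: diag_char_image)
  qed
  have "fourier n (B.conv n f g) r Z = (\<Sum>p\<in>?S. \<Sum>X\<in>?N. \<Sum>q\<in>?S. \<Sum>Y\<in>?N.
      f (smat n p X) * g (smat n q Y) * ?\<phi> (smat n p X * smat n q Y))"
    unfolding fourier_eq_linear_extension[OF r] B.linear_extension_conv sum_B_group B_group_simps ..
  also have "\<dots> = (\<Sum>p\<in>?S. \<Sum>X\<in>?N. \<Sum>q\<in>?S. \<Sum>Y\<in>?N.
      if p \<circ> q = r then (diag_char (q ` Z) X * f (smat n p X)) * (diag_char Z Y * g (smat n q Y)) else 0)"
    by (intro sum.cong refl) (simp only: \<phi>, simp)
  also have "\<dots> = (\<Sum>p\<in>?S. \<Sum>q\<in>?S. \<Sum>X\<in>?N. \<Sum>Y\<in>?N.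
      if p \<circ> q = r then (diag_char (q ` Z) X * f (smat n p X)) * (diag_char Z Y * g (smat n q Y)) else 0)"
    by (intro sum.cong refl sum.swap)
  also have "\<dots> = (\<Sum>p\<in>?S. \<Sum>q\<in>?S. if p \<circ> q = r then fourier n f p (q ` Z) * fourier n g q Z else 0)"
  proof (intro sum.cong refl)
    fix p q
    show "(\<Sum>X\<in>?N. \<Sum>Y\<in>?N.
      if p \<circ> q = r then (diag_char (q ` Z) X * f (smat n p X)) * (diag_char Z Y * g (smat n q Y)) else 0)
      = (if p \<circ> q = r then fourier n f p (q ` Z) * fourier n g q Z else 0)"
      by (cases "p \<circ> q = r") (simp_all add: fourier_def sum_product)
  qed
  finally show ?thesis .
qed

lemma fourier_inversion:
  assumes Y: "Y \<subseteq> {1..n}"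
  shows "(\<Sum>X\<in>Pow {1..n}. diag_char X Y * fourier n f p X) = 2 ^ n * f (smat n p Y)"
proof -
  have "(\<Sum>X\<in>Pow {1..n}. diag_char X Y * fourier n f p X)
    = (\<Sum>Z\<in>Pow {1..n}. (\<Sum>X\<in>Pow {1..n}. diag_char X Y * diag_char X Z) * f (smat n p Z))"
    unfolding fourier_def sum_distrib_left sum_distrib_right
    by (subst sum.swap) (simp only: mult.assoc)
  also have "\<dots> = (\<Sum>Z\<in>Pow {1..n}. if Z = Y then 2 ^ n * f (smat n p Y) else 0)"
    using Y by (intro sum.cong refl) (subst diag_char_orthogonal, auto)
  finally show ?thesis using Y by simp
qed

lemma fourier_eqI:
  assumes "f \<in> B.alg n" "g \<in> B.alg n"
    and eq: "\<And>p X. p permutes {1..n} \<Longrightarrow> X \<subseteq> {1..n} \<Longrightarrow> fourier n f p X = fourier n g p X"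
  shows "f = g"
proof (rule B.alg_eqI[OF assms(1,2)])
  fix A assume "A \<in> carrier (B_group n)"
  then obtain p Y where A: "p permutes {1..n}" "Y \<subseteq> {1..n}" "A = smat n p Y"
    by (rule B_group_eq_smat)
  have "2 ^ n * f A = (\<Sum>X\<in>Pow {1..n}. diag_char X Y * fourier n f p X)"
    by (simp only: A(3) fourier_inversion[OF A(2)])
  also have "\<dots> = (\<Sum>X\<in>Pow {1..n}. diag_char X Y * fourier n g p X)"
    using eq A(1) by (intro sum.cong refl) simp
  also have "\<dots> = 2 ^ n * g A"
    by (simp only: A(3) fourier_inversion[OF A(2)])
  finally show "f A = g A" by simp
qed

text \<open>
  The map \<open>p e\<^sub>X \<mapsto> inversion_sign X p \<cdot> p e\<^sub>X\<close>, written in the basis of group elements by Fourier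
  inversion on the diagonal subgroup.
\<close>

definition sign_twist :: "nat \<Rightarrow> (int mat \<Rightarrow> complex) \<Rightarrow> int mat \<Rightarrow> complex" where
  "sign_twist n f A = (if A \<in> carrier (B_group n) then
     (\<Sum>X\<in>Pow {1..n}. diag_char X (neg_cols n A) * (of_int (inversion_sign X (B_proj n A)) * fourier n f (B_proj n A) X)) / 2 ^ n
   else 0)"

lemma sign_twist_in_alg [simp]: "sign_twist n f \<in> B.alg n"
  by (simp add: B.alg_iff sign_twist_def)

lemma fourier_sign_twist:
  assumes p: "p permutes {1..n}" and Z: "Z \<subseteq> {1..n}"
  shows "fourier n (sign_twist n f) p Z = of_int (inversion_sign Z p) * fourier n f p Z"
proof -
  let ?N = "Pow {1..n}" and ?u = "\<lambda>X. of_int (inversion_sign X p) * fourier n f p X"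
  have fin: "finite X" if "X \<in> ?N" for X using that finite_subset by auto
  have "fourier n (sign_twist n f) p Z = (\<Sum>Y\<in>?N. diag_char Z Y * ((\<Sum>X\<in>?N. diag_char X Y * ?u X) / 2 ^ n))"
    unfolding fourier_def[of n "sign_twist n f"]
  proof (intro sum.cong refl)
    fix Y assume "Y \<in> ?N"
    then have "neg_cols n (smat n p Y) = Y" using neg_cols_smat[OF p] by blast
    then show "diag_char Z Y * sign_twist n f (smat n p Y) = diag_char Z Y * ((\<Sum>X\<in>?N. diag_char X Y * ?u X) / 2 ^ n)"
      using smat_in_B_group[OF p] by (simp only: sign_twist_def B_proj_smat[OF p] if_True)
  qed
  also have "\<dots> = (\<Sum>X\<in>?N. (\<Sum>Y\<in>?N. diag_char Z Y * diag_char X Y) * (?u X / 2 ^ n))"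
    unfolding sum_distrib_left sum_distrib_right sum_divide_distrib
    by (subst sum.swap) (simp add: mult.assoc)
  also have "\<dots> = (\<Sum>X\<in>?N. if X = Z then ?u Z else 0)"
  proof (intro sum.cong refl)
    fix X assume X: "X \<in> ?N"
    \<comment> \<open>The diagonal subgroup is identified with its dual, so orthogonality may be summed over group elements instead of characters.\<close>
    have "(\<Sum>Y\<in>?N. diag_char Z Y * diag_char X Y) = (\<Sum>Y\<in>?N. diag_char Y Z * diag_char Y X)"
      using X Z fin by (intro sum.cong refl arg_cong2[where f = "(*)"] diag_char_commute) auto
    also have "\<dots> = (if Z = X then 2 ^ n else 0)"
      using X Z by (subst diag_char_orthogonal) auto
    finally show "(\<Sum>Y\<in>?N. diag_char Z Y * diag_char X Y) * (?u X / 2 ^ n) = (if X = Z then ?u Z else 0)"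
      by auto
  qed
  also have "\<dots> = ?u Z" using Z by simp
  finally show ?thesis .
qed

lemma sign_twist_involution: "f \<in> B.alg n \<Longrightarrow> sign_twist n (sign_twist n f) = f"
proof (rule fourier_eqI[of _ n])
  fix p X assume p: "p permutes {1..n}" and X: "X \<subseteq> {1..n}"
  have "of_int (inversion_sign X p) * of_int (inversion_sign X p) = (1 :: complex)"
    by (simp only: of_int_mult[symmetric] inversion_sign_square of_int_1)
  then show "fourier n (sign_twist n (sign_twist n f)) p X = fourier n f p X"
    unfolding fourier_sign_twist[OF p X] mult.assoc[symmetric] by simp
qed simp_all

text \<open>
  Multiplicativity on the basis elements \<open>p e\<^sub>q\<^sub>Z\<close> and \<open>q e\<^sub>Z\<close> is the cocycle identity for the inversion
  sign.
\<close>

lemma sign_twist_conv: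
  "sign_twist n (B.conv n f g) = B.conv n (sign_twist n f) (sign_twist n g)"
proof (rule fourier_eqI[of _ n])
  fix r Z assume r: "r permutes {1..n}" and Z: "Z \<subseteq> {1..n}"
  show "fourier n (sign_twist n (B.conv n f g)) r Z = fourier n (B.conv n (sign_twist n f) (sign_twist n g)) r Z"
    unfolding fourier_sign_twist[OF r Z] fourier_conv[OF r] sum_distrib_left
  proof (intro sum.cong refl)
    fix p q assume "p \<in> {p. p permutes {1..n}}" "q \<in> {p. p permutes {1..n}}"
    then have p: "p permutes {1..n}" and q: "q permutes {1..n}" by auto
    have qZ: "q ` Z \<subseteq> {1..n}" using Z permutes_image[OF q] by blast
    have "inversion_sign Z (p \<circ> q) = inversion_sign (q ` Z) p * inversion_sign Z q"
      by (rule inversion_sign_comp[OF permutes_inj_on[OF q] permutes_inj_on[OF p]])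
    then show "of_int (inversion_sign Z r) * (if p \<circ> q = r then fourier n f p (q ` Z) * fourier n g q Z else 0)
      = (if p \<circ> q = r then fourier n (sign_twist n f) p (q ` Z) * fourier n (sign_twist n g) q Z else 0)"
      unfolding fourier_sign_twist[OF p qZ] fourier_sign_twist[OF q Z] by auto
  qed
qed auto

lemma sign_twist_in_algebra_auts: "restrict (sign_twist n) (B.alg n) \<in> algebra_auts (B_group n)"
proof -
  have add: "sign_twist n (f + g) = sign_twist n f + sign_twist n g" for f g
    by (auto simp: fun_eq_iff sign_twist_def fourier_add algebra_simps sum.distrib add_divide_distrib)
  have scale: "sign_twist n (cscale c f) = cscale c (sign_twist n f)" for c f
    unfolding sign_twist_def fourier_cscale
    by (auto simp: fun_eq_iff cscale_def sum_distrib_left algebra_simps)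
  have one: "\<one>\<^bsub>group_algebra (B_group n)\<^esub> = delta (smat n id {})"
    by (simp add: group_algebra_def delta_def smat_id)
  have one_alg: "delta (smat n id {}) \<in> B.alg n"
    using smat_in_B_group[OF permutes_id] by simp
  have twist_one: "sign_twist n (delta (smat n id {})) = delta (smat n id {})"
  proof (rule fourier_eqI[of _ n])
    fix p X assume p: "p permutes {1..n}" and X: "X \<subseteq> {1..n}"
    have "inversion_sign X id = 1" by (rule inversion_sign_mono) simp
    then show "fourier n (sign_twist n (delta (smat n id {}))) p X = fourier n (delta (smat n id {})) p X"
      unfolding fourier_sign_twist[OF p X] fourier_delta[OF permutes_id p empty_subsetI] by auto
  qed (simp_all add: one_alg)
  have plus: "add (group_algebra (B_group n)) = (+)"
    by (simp add: group_algebra_def)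
  have sub: "f + g \<in> B.alg n" "cscale c f \<in> B.alg n" if "f \<in> B.alg n" "g \<in> B.alg n" for f g c
    using that fs.subspace_add[OF B.alg_subspace] fs.subspace_scale[OF B.alg_subspace] by auto
  have "restrict (sign_twist n) (B.alg n) \<in> Ring.ring_hom (group_algebra (B_group n)) (group_algebra (B_group n))"
    using one_alg sub by (intro ring_hom_memI) (simp_all add: sign_twist_conv plus add one twist_one)
  moreover have "bij_betw (restrict (sign_twist n) (B.alg n)) (B.alg n) (B.alg n)"
    by (rule bij_betw_byWitness[where f' = "sign_twist n"]) (auto simp: sign_twist_involution)
  ultimately show ?thesis
    using sub by (auto simp: algebra_auts_def ring_iso_def scale)
qed

lemma sign_twist_t_gen:
  assumes i: "i \<in> {1..n}"
  shows "sign_twist n (delta (t_gen n i)) = delta (t_gen n i)"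
proof (rule fourier_eqI[of _ n])
  fix p X assume p: "p permutes {1..n}" and X: "X \<subseteq> {1..n}"
  have Y: "{i} \<subseteq> {1..n}" using i by simp
  have "inversion_sign X id = 1" by (rule inversion_sign_mono) simp
  then show "fourier n (sign_twist n (delta (t_gen n i))) p X = fourier n (delta (t_gen n i)) p X"
    unfolding t_gen_eq_smat fourier_sign_twist[OF p X] fourier_delta[OF permutes_id p Y] by auto
qed (use smat_in_B_group[OF permutes_id] in \<open>simp_all add: t_gen_eq_smat\<close>)

text \<open>
  Both sides multiply \<open>s\<^sub>i e\<^sub>X\<close> by the same scalar: with \<open>x\<close> and \<open>y\<close> the values of the character \<open>X\<close> at
  \<open>t\<^sub>i\<close> and \<open>t\<^sub>i\<^sub>+\<^sub>1\<close>, the number \<open>(1 + x + y - x y) / 2\<close> is \<open>-1\<close> if \<open>x = y = -1\<close> and \<open>1\<close> otherwise.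
\<close>

lemma sign_twist_s_gen:
  assumes i: "i \<in> {1..<n}"
  shows "sign_twist n (delta (s_gen n i)) = cscale (1/2) (B.conv n (delta (s_gen n i))
    (delta (1\<^sub>m n) + delta (t_gen n i) + delta (t_gen n (i + 1)) - delta (t_gen n i * t_gen n (i + 1))))"
proof (rule fourier_eqI[of _ n])
  let ?s = "Transposition.transpose i (Suc i)"
  fix r X assume r: "r permutes {1..n}" and X: "X \<subseteq> {1..n}"
  have s: "?s permutes {1..n}" using i by (intro permutes_swap_id) auto
  have fin: "finite X" using X finite_subset by auto
  let ?u = "delta (1\<^sub>m n) + delta (t_gen n i) + delta (t_gen n (i + 1)) - delta (t_gen n i * t_gen n (i + 1))"
  let ?c = "1 + diag_char X {i} + diag_char X {Suc i} - diag_char X {i} * diag_char X {Suc i}"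
  have tt: "t_gen n i * t_gen n (i + 1) = smat n id {i, Suc i}"
    unfolding t_gen_eq_smat smat_mult[OF permutes_id] by (rule smat_cong) auto
  have "{i, Suc i} = sym_diff {i} {Suc i}" by auto
  then have ch2: "diag_char X {i, Suc i} = diag_char X {i} * diag_char X {Suc i}" by (simp only: diag_char_sym_diff)
  have subs: "{i} \<subseteq> {1..n}" "{Suc i} \<subseteq> {1..n}" "{i, Suc i} \<subseteq> {1..n}" "{} \<subseteq> {1..n}" using i by auto
  \<comment> \<open>The sum of diagonal matrices has coefficients at the identity permutation only, the scalars by which it acts on the idempotents.\<close>
  have u: "fourier n ?u q X = (if id = q then ?c else 0)" if q: "q permutes {1..n}" for q
    unfolding fourier_add fourier_diff tt
    unfolding smat_id[symmetric] t_gen_eq_smat Suc_eq_plus1[symmetric]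
      fourier_delta[OF permutes_id q subs(1)] fourier_delta[OF permutes_id q subs(2)]
      fourier_delta[OF permutes_id q subs(3)] fourier_delta[OF permutes_id q subs(4)] ch2
    by simp
  have "fourier n (B.conv n (delta (s_gen n i)) ?u) r X
    = (\<Sum>p | p permutes {1..n}. \<Sum>q | q permutes {1..n}. if q = id then (if p = ?s then (if ?s = r then ?c else 0) else 0) else 0)"
    unfolding fourier_conv[OF r]
  proof (intro sum.cong refl)
    fix p q assume "p \<in> {p. p permutes {1..n}}" "q \<in> {p. p permutes {1..n}}"
    then have p: "p permutes {1..n}" and q: "q permutes {1..n}" by auto
    show "(if p \<circ> q = r then fourier n (delta (s_gen n i)) p (q ` X) * fourier n ?u q X else 0)
      = (if q = id then (if p = ?s then (if ?s = r then ?c else 0) else 0) else 0)"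
      unfolding u[OF q] s_gen_eq_smat fourier_delta[OF s p subs(4)] by auto
  qed
  also have "\<dots> = (if ?s = r then ?c else 0)"
    using s permutes_id by (simp add: finite_permutations)
  finally have rhs: "fourier n (B.conv n (delta (s_gen n i)) ?u) r X = (if ?s = r then ?c else 0)" .
  have "fourier n (sign_twist n (delta (s_gen n i))) r X = (if ?s = r then of_int (inversion_sign X ?s) else 0)"
    unfolding s_gen_eq_smat fourier_sign_twist[OF r X] fourier_delta[OF s r subs(4)] by auto
  moreover have "of_int (inversion_sign X ?s) = ?c / 2"
    using fin by (simp add: inversion_sign_adjacent diag_char_singleton)
  ultimately show "fourier n (sign_twist n (delta (s_gen n i))) r X = fourier n (cscale (1/2) (B.conv n (delta (s_gen n i)) ?u)) r X"
    unfolding fourier_cscale rhs by (cases "?s = r") simp_all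
qed (use fs.subspace_scale[OF B.alg_subspace] in auto)

text \<open>
  By linearity it is enough to compare \<open>h\<close> and \<open>k\<close> at group elements, where they agree by
  multiplicativity because the generators generate the group.
\<close>

lemma algebra_aut_unique:
  assumes h: "h \<in> algebra_auts (B_group n)" and k: "k \<in> algebra_auts (B_group n)"
    and t: "\<And>i. i \<in> {1..n} \<Longrightarrow> h (delta (t_gen n i)) = k (delta (t_gen n i))"
    and s: "\<And>i. i \<in> {1..<n} \<Longrightarrow> h (delta (s_gen n i)) = k (delta (s_gen n i))"
    and f: "f \<in> B.alg n"
  shows "h f = k f"
proof -
  have mult: "l (B.conv n f g) = B.conv n (l f) (l g)"
    and add: "l (f + g) = l f + l g" and scale: "l (cscale c f) = cscale c (l f)"
    and unit: "l (delta (1\<^sub>m n)) = delta (1\<^sub>m n)"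
    if l: "l \<in> algebra_auts (B_group n)" and fg: "f \<in> B.alg n" "g \<in> B.alg n" for l f g c
  proof -
    have "l \<in> Ring.ring_hom (group_algebra (B_group n)) (group_algebra (B_group n))"
      using l by (simp add: algebra_auts_def ring_iso_def)
    from ring_hom_mult[OF this fg] ring_hom_add[OF this fg] ring_hom_one[OF this]
    show "l (B.conv n f g) = B.conv n (l f) (l g)" "l (f + g) = l f + l g"
      "l (delta (1\<^sub>m n)) = delta (1\<^sub>m n)"
      by (simp_all add: group_algebra_def delta_def)
    show "l (cscale c f) = cscale c (l f)" using l fg by (simp add: algebra_auts_def)
  qed
  have step: "h (delta (a * A)) = k (delta (a * A))"
    if "a \<in> carrier (B_group n)" "A \<in> carrier (B_group n)" "h (delta a) = k (delta a)" "h (delta A) = k (delta A)" for a A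
    using that mult[OF h, of "delta a" "delta A"] mult[OF k, of "delta a" "delta A"]
      B.delta_conv_delta[of a n A] by simp
  have zero: "0 \<in> B.alg n" by (simp add: B.alg_iff)
  have delta: "h (delta A) = k (delta A)" if "A \<in> carrier (B_group n)" for A
    using that
  proof (induction rule: B_group_induct)
    case one
    show ?case using unit[OF h zero zero] unit[OF k zero zero] by simp
  next
    case (t i A)
    then show ?case using assms(3) by (intro step t_gen_in_B_group)
  next
    case (s i A)
    then show ?case using assms(4) by (intro step s_gen_in_B_group)
  qed
  let ?E = "\<lambda>A. cscale (f A) (delta A)"
  have E: "?E A \<in> B.alg n" if "A \<in> carrier (B_group n)" for A
    using that fs.subspace_scale[OF B.alg_subspace] by simp
  have "h (sum ?E S) = k (sum ?E S) \<and> sum ?E S \<in> B.alg n" if "finite S" "S \<subseteq> carrier (B_group n)" for S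
    using that
  proof induction
    case empty
    have "h 0 = cscale 0 (h 0)" "k 0 = cscale 0 (k 0)"
      using scale[OF h zero zero, of 0] scale[OF k zero zero, of 0] by simp_all
    then have "h 0 = k 0" by simp
    then show ?case using zero by (simp only: sum.empty)
  next
    case (insert A S)
    have A: "A \<in> carrier (B_group n)" and IH: "h (sum ?E S) = k (sum ?E S)" "sum ?E S \<in> B.alg n"
      using insert.IH insert.prems by blast+
    have dA: "delta A \<in> B.alg n" using A by (rule B.delta_in_alg)
    have "h (?E A) = k (?E A)"
      using scale[OF h dA zero] scale[OF k dA zero] delta[OF A] by simp
    then have "h (?E A + sum ?E S) = k (?E A + sum ?E S)"
      by (simp only: add[OF h E[OF A] IH(2)] add[OF k E[OF A] IH(2)] IH(1))
    moreover have "?E A + sum ?E S \<in> B.alg n"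
      by (rule fs.subspace_add[OF B.alg_subspace E[OF A] IH(2)])
    ultimately show ?case
      by (simp only: sum.insert[OF insert.hyps])
  qed
  from this[OF B.finite_carrier subset_refl] show ?thesis
    unfolding B.alg_expand[OF f, symmetric] by (rule conjunct1)
qed

text \<open>
  The sign twist has the values on the generators that determine \<open>eta_phi n\<close>.
\<close>

lemma eta_phi_eq_sign_twist:
  assumes f: "f \<in> B.alg n"
  shows "eta_phi n f = sign_twist n f"
proof -
  let ?h = "restrict (sign_twist n) (B.alg n)"
  let ?P = "\<lambda>h. h \<in> extensional (B.alg n) \<and> h \<in> algebra_auts (B_group n) \<and>
     (\<forall>i \<in> {1..n}. h (delta (t_gen n i)) = delta (t_gen n i)) \<and>
     (\<forall>i \<in> {1..<n}. h (delta (s_gen n i)) =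
        cscale (1/2) (B.conv n (delta (s_gen n i))
          (delta (1\<^sub>m n) + delta (t_gen n i) + delta (t_gen n (i + 1))
             - delta (t_gen n i * t_gen n (i + 1)))))"
  have P: "?P ?h"
    using sign_twist_in_algebra_auts sign_twist_t_gen sign_twist_s_gen t_gen_in_B_group s_gen_in_B_group
    by (simp del: One_nat_def)
  have "eta_phi n = ?h"
    unfolding eta_phi_def
  proof (rule the_equality[where P = ?P, OF P])
    fix h assume h: "?P h"
    show "h = ?h"
    proof (rule extensionalityI[of _ "B.alg n"])
      fix f assume "f \<in> B.alg n"
      show "h f = ?h f"
      proof (rule algebra_aut_unique[OF _ _ _ _ \<open>f \<in> B.alg n\<close>])
        show "h (delta (t_gen n i)) = ?h (delta (t_gen n i))" if "i \<in> {1..n}" for i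
          using h P that by metis
        show "h (delta (s_gen n i)) = ?h (delta (s_gen n i))" if "i \<in> {1..<n}" for i
          using h P that by metis
      qed (use h P in blast)+
    qed (use h in auto)
  qed
  then show ?thesis using f by simp
qed

section \<open>Induced characters in the basis of idempotents\<close>

text \<open>
  The two blocks of a permutation of \<open>{1..a+b}\<close> that preserves \<open>{a+1..a+b}\<close>, the second one renumbered
  to act on \<open>{1..b}\<close>.
\<close>

definition upper_part :: "nat \<Rightarrow> (nat \<Rightarrow> nat) \<Rightarrow> nat \<Rightarrow> nat" where
  "upper_part a q k = (if k \<in> {1..a} then q k else k)"

definition lower_part :: "nat \<Rightarrow> nat \<Rightarrow> (nat \<Rightarrow> nat) \<Rightarrow> nat \<Rightarrow> nat" where
  "lower_part a b q k = (if k \<in> {1..b} then q (k + a) - a else k)"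

lemma image_eq_of_permutes:
  fixes a b :: nat
  assumes "q permutes {1..a + b}"
  shows "q ` {a+1..a+b} = {a+1..a+b} \<longleftrightarrow> q ` {a+1..a+b} \<subseteq> {a+1..a+b}"
proof
  assume "q ` {a+1..a+b} \<subseteq> {a+1..a+b}"
  then show "q ` {a+1..a+b} = {a+1..a+b}"
    using card_image[OF permutes_inj_on[OF assms]] by (intro card_subset_eq) auto
qed simp

lemma upper_part_permutes:
  assumes q: "q permutes {1..a + b}" and Z: "q ` {a+1..a+b} = {a+1..a+b}"
  shows "upper_part a q permutes {1..a}"
proof -
  have diff: "{1..a} = {1..a + b} - {a+1..a+b}" by auto
  have "q ` {1..a} = {1..a}"
    unfolding diff using Z permutes_image[OF q] by (simp only: image_set_diff[OF permutes_inj[OF q]])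
  then have "bij_betw (upper_part a q) {1..a} {1..a}"
    using permutes_inj_on[OF q] by (subst bij_betw_cong[of _ _ q]) (auto simp: upper_part_def bij_betw_def)
  then show ?thesis by (rule bij_imp_permutes) (auto simp: upper_part_def)
qed

lemma lower_part_permutes:
  assumes q: "q permutes {1..a + b}" and Z: "q ` {a+1..a+b} = {a+1..a+b}"
  shows "lower_part a b q permutes {1..b}"
proof -
  have im: "(\<lambda>k. k + a) ` {1..b} = {a+1..a+b}"
    by (simp add: add.commute)
  have "bij_betw (\<lambda>k. k + a) {1..b} {a+1..a+b}"
    using im by (simp add: bij_betw_def)
  moreover have "bij_betw q {a+1..a+b} {a+1..a+b}"
    using Z permutes_inj_on[OF q] by (simp add: bij_betw_def)
  moreover have "bij_betw (\<lambda>k. k - a) {a+1..a+b} {1..b}"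
    by (rule bij_betw_byWitness[where f' = "\<lambda>k. k + a"]) auto
  ultimately have "bij_betw ((\<lambda>k. k - a) \<circ> (q \<circ> (\<lambda>k. k + a))) {1..b} {1..b}"
    by (intro bij_betw_trans)
  then have "bij_betw (lower_part a b q) {1..b} {1..b}"
    by (subst bij_betw_cong[of _ _ "(\<lambda>k. k - a) \<circ> (q \<circ> (\<lambda>k. k + a))"]) (auto simp: lower_part_def)
  then show ?thesis by (rule bij_imp_permutes) (auto simp: lower_part_def)
qed

text \<open>
  The renumbering is increasing, so it creates no inversions and contributes nothing to the cocycle.
\<close>

lemma sign_lower_part:
  assumes q: "q permutes {1..a + b}" and Z: "q ` {a+1..a+b} = {a+1..a+b}"
  shows "sign (lower_part a b q) = inversion_sign {a+1..a+b} q"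
proof -
  let ?Z = "{a+1..a+b}" and ?u = "\<lambda>k. k + a" and ?d = "\<lambda>k. k - a"
  have im: "?u ` {1..b} = ?Z" by (simp add: add.commute)
  have u: "inversion_sign {1..b} ?u = 1" by (rule inversion_sign_mono) simp
  have d: "inversion_sign ?Z ?d = 1" by (rule inversion_sign_mono) auto
  have inj_d: "inj_on ?d ?Z" by (rule inj_onI) auto
  have inj_u: "inj_on ?u {1..b}" by (rule inj_onI) simp
  note inj_q = permutes_inj_on[OF q]
  have "sign (lower_part a b q) = inversion_sign {1..b} (lower_part a b q)"
    by (rule sign_eq_inversion_sign[OF lower_part_permutes[OF q Z]])
  also have "\<dots> = inversion_sign {1..b} (?d \<circ> (q \<circ> ?u))"
    by (rule inversion_sign_cong) (simp add: lower_part_def)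
  also have "\<dots> = inversion_sign ((q \<circ> ?u) ` {1..b}) ?d * inversion_sign {1..b} (q \<circ> ?u)"
    using inj_d comp_inj_on[OF inj_u inj_q] by (intro inversion_sign_comp) (simp_all only: image_comp[symmetric] im Z)
  also have "(q \<circ> ?u) ` {1..b} = ?Z"
    by (simp only: image_comp[symmetric] im Z)
  also have "inversion_sign {1..b} (q \<circ> ?u) = inversion_sign (?u ` {1..b}) q * inversion_sign {1..b} ?u"
    by (rule inversion_sign_comp[OF inj_u inj_q])
  finally show ?thesis by (simp only: u d im mult_1 mult_1_right)
qed

lemma smat_eq_four_block:
  assumes q: "q permutes {1..a + b}" and Z: "q ` {a+1..a+b} = {a+1..a+b}"
  shows "smat (a + b) q W = four_block_mat (smat a (upper_part a q) W) (0\<^sub>m a b) (0\<^sub>m b a)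
    (smat b (lower_part a b q) ((\<lambda>k. k + a) -` W))"
proof (rule eq_matI)
  let ?R = "four_block_mat (smat a (upper_part a q) W) (0\<^sub>m a b) (0\<^sub>m b a)
    (smat b (lower_part a b q) ((\<lambda>k. k + a) -` W))"
  fix i j assume "i < dim_row ?R" "j < dim_col ?R"
  then have ij: "i < a + b" "j < a + b" by auto
  have diff: "{1..a} = {1..a + b} - {a+1..a+b}" by auto
  have Y: "q ` {1..a} = {1..a}"
    unfolding diff using Z permutes_image[OF q] by (simp only: image_set_diff[OF permutes_inj[OF q]])
  have up: "q (Suc j) \<in> {1..a}" if "j < a"
    using Y that by (metis Suc_le_eq atLeastAtMost_iff image_eqI le_add1 plus_1_eq_Suc)
  have lo: "q (Suc j) \<in> {a+1..a+b}" if "\<not> j < a"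
  proof -
    have "Suc j \<in> {a+1..a+b}" using that ij by auto
    then show ?thesis using Z by blast
  qed
  show "smat (a + b) q W $$ (i, j) = ?R $$ (i, j)"
  proof (cases "j < a")
    case True
    then show ?thesis using ij up[OF True] by (auto simp: upper_part_def)
  next
    case False
    then show ?thesis using ij lo[OF False] by (auto simp: lower_part_def)
  qed
qed auto

lemma smat_in_B_block:
  assumes q: "q permutes {1..a + b}"
  shows "smat (a + b) q W \<in> B_block a b \<longleftrightarrow> q ` {a+1..a+b} = {a+1..a+b}"
proof
  assume Z: "q ` {a+1..a+b} = {a+1..a+b}"
  show "smat (a + b) q W \<in> B_block a b"
    unfolding B_block_def smat_eq_four_block[OF q Z]
    using smat_in_B_group upper_part_permutes[OF q Z] lower_part_permutes[OF q Z] by blast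
next
  assume "smat (a + b) q W \<in> B_block a b"
  then obtain A D where eq: "smat (a + b) q W = four_block_mat A (0\<^sub>m a b) (0\<^sub>m b a) D"
    and A: "A \<in> carrier (B_group a)" and D: "D \<in> carrier (B_group b)"
    by (auto simp: B_block_def)
  have dim: "dim_row A = a" "dim_col A = a" "dim_row D = b" "dim_col D = b"
    using A D by (auto simp: B_group_def)
  have "q ` {a+1..a+b} \<subseteq> {a+1..a+b}"
  proof
    fix y assume "y \<in> q ` {a+1..a+b}"
    then obtain k where k: "k \<in> {a+1..a+b}" "y = q k" by blast
    then have kn: "k \<in> {1..a+b}" by auto
    then have y: "y \<in> {1..a+b}" using k permutes_in_image[OF q] by blast
    have "smat (a + b) q W $$ (y - 1, k - 1) \<noteq> 0"
      using k by (subst smat_index_pred[OF y kn]) auto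
    moreover have "smat (a + b) q W $$ (y - 1, k - 1) = 0" if "y - 1 < a"
    proof -
      have "k - 1 < a + b" "\<not> k - 1 < a" "k - 1 - a < b" using k kn by auto
      then show ?thesis unfolding eq using that dim by simp
    qed
    ultimately have "\<not> y - 1 < a" by blast
    then show "y \<in> {a+1..a+b}" using y by auto
  qed
  then show "q ` {a+1..a+b} = {a+1..a+b}" by (simp only: image_eq_of_permutes[OF q])
qed

lemma B_block_character_smat:
  assumes q: "q permutes {1..a + b}" and Z: "q ` {a+1..a+b} = {a+1..a+b}"
    and a: "sum_list ls = a" and b: "sum_list ms = b"
  shows "B_block_character ls ms (smat (a + b) q W) = diag_char {a+1..a+b} W *
    (sym_character ls (upper_part a q) * sym_character ms (lower_part a b q))"
proof -
  let ?A = "smat a (upper_part a q) W" and ?D = "smat b (lower_part a b q) ((\<lambda>k. k + a) -` W)"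
  note up = upper_part_permutes[OF q Z] and lp = lower_part_permutes[OF q Z]
  have split: "split_block (four_block_mat ?A (0\<^sub>m a b) (0\<^sub>m b a) ?D) a a = (?A, 0\<^sub>m a b, 0\<^sub>m b a, ?D)"
    unfolding split_block_def Let_def by (auto intro!: eq_matI)
  have "?D = smat b (lower_part a b q) ((\<lambda>k. k + a) -` W \<inter> {1..b})"
    by (rule smat_cong) auto
  then have "eps' b ?D = diag_char {1..b} ((\<lambda>k. k + a) -` W \<inter> {1..b})"
    using eps'_smat[OF lp, of "(\<lambda>k. k + a) -` W \<inter> {1..b}"] by simp
  also have "\<dots> = diag_char {1..b} ((\<lambda>k. k + a) -` W)"
    by (rule diag_char_cong) auto
  also have "\<dots> = diag_char ((\<lambda>k. k + a) ` {1..b}) W"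
    by (rule diag_char_image[symmetric]) (simp add: inj_on_def)
  also have "(\<lambda>k. k + a) ` {1..b} = {a+1..a+b}"
    by (simp add: add.commute)
  finally have eps: "eps' b ?D = diag_char {a+1..a+b} W" .
  show ?thesis
    unfolding B_block_character_def smat_eq_four_block[OF q Z] Let_def a b split prod.case eps
      B_proj_smat[OF up] B_proj_smat[OF lp]
    by (simp only: mult_ac)
qed

lemma inv_smat:
  assumes r: "r permutes {1..n}"
  shows "inv\<^bsub>B_group n\<^esub> (smat n r R) = smat n (inv' r) (r ` R)"
  using smat_left_inverse[OF r, of R] smat_in_B_group[OF r] smat_in_B_group[OF permutes_inv[OF r]]
  by (intro B.inv_equality) simp_all

lemma smat_conj:
  assumes r: "r permutes {1..n}" and p: "p permutes {1..n}"
  shows "inv\<^bsub>B_group n\<^esub> (smat n r R) * smat n p Y * smat n r R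
    = smat n (inv' r \<circ> p \<circ> r) (sym_diff (r -` sym_diff (p -` (r ` R)) Y) R)"
  by (simp only: inv_smat[OF r] smat_mult[OF p] smat_mult[OF r])

lemma conj_preserves_iff:
  assumes r: "r permutes A"
  shows "(inv' r \<circ> p \<circ> r) ` Z = Z \<longleftrightarrow> p ` (r ` Z) = r ` Z"
proof -
  have "r ` ((inv' r \<circ> p \<circ> r) ` Z) = p ` (r ` Z)"
    by (simp add: image_image permutes_inverses[OF r])
  then show ?thesis using inj_image_eq_iff[OF permutes_inj[OF r]] by metis
qed

text \<open>
  Conjugating by the element with permutation \<open>r\<close> and signs \<open>R\<close> moves the character \<open>Z\<close> of the diagonal
  subgroup to \<open>r ` Z\<close>. The signs \<open>R\<close> enter twice and cancel, because \<open>p\<close> preserves \<open>r ` Z\<close>.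
\<close>

lemma diag_char_conj:
  assumes r: "inj r" and p: "inj p" and Z: "p ` (r ` Z) = r ` Z"
  shows "diag_char Z (sym_diff (r -` sym_diff (p -` (r ` R)) Y) R) = diag_char (r ` Z) Y"
proof -
  have "diag_char Z (r -` sym_diff (p -` (r ` R)) Y) = diag_char (r ` Z) (sym_diff (p -` (r ` R)) Y)"
    using r by (simp only: diag_char_image[OF inj_on_subset[OF r subset_UNIV]])
  also have "\<dots> = diag_char (r ` Z) (p -` (r ` R)) * diag_char (r ` Z) Y"
    by (rule diag_char_sym_diff)
  also have "diag_char (r ` Z) (p -` (r ` R)) = diag_char (r ` Z) (r ` R)"
    using diag_char_image[OF inj_on_subset[OF p subset_UNIV], of "r ` Z" "r ` R"] by (simp only: Z)
  also have "\<dots> = diag_char Z R"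
    by (simp only: diag_char_image[OF inj_on_subset[OF r subset_UNIV]] inj_vimage_image_eq[OF r])
  finally show ?thesis
    using diag_char_square[of Z R] by (simp only: diag_char_sym_diff mult_ac) (simp add: mult.assoc[symmetric])
qed

definition block_term :: "nat list \<Rightarrow> nat list \<Rightarrow> (nat \<Rightarrow> nat) \<Rightarrow> complex" where
  "block_term ls ms q = sym_character ls (upper_part (sum_list ls) q)
    * sym_character ms (lower_part (sum_list ls) (sum_list ms) q)"

text \<open>
  In the formula for the induced character the conjugating elements with the same permutation \<open>r\<close>
  contribute equally, which gives the factor \<open>2 ^ (a + b)\<close>.
\<close>

lemma B_character_smat:
  assumes p: "p permutes {1..a + b}" and a: "sum_list ls = a" and b: "sum_list ms = b"
  shows "B_character ls ms (smat (a + b) p Y) = 2 ^ (a + b) / of_nat (card (B_block a b)) *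
    (\<Sum>r | r permutes {1..a + b} \<and> p ` (r ` {a+1..a+b}) = r ` {a+1..a+b}.
      diag_char (r ` {a+1..a+b}) Y * block_term ls ms (inv' r \<circ> p \<circ> r))"
proof -
  let ?n = "a + b" and ?G = "B_group (a + b)" and ?g = "smat (a + b) p Y" and ?Z = "{a+1..a+b}"
  let ?S = "{r. r permutes {1..?n}}"
  let ?F = "\<lambda>x. if inv\<^bsub>?G\<^esub> x * ?g * x \<in> B_block a b then B_block_character ls ms (inv\<^bsub>?G\<^esub> x * ?g * x) else 0"
  let ?t = "\<lambda>r. if p ` (r ` ?Z) = r ` ?Z then diag_char (r ` ?Z) Y * block_term ls ms (inv' r \<circ> p \<circ> r) else 0"
  \<comment> \<open>The summand does not depend on the signs \<open>R\<close> of the conjugating element.\<close>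
  have F: "?F (smat ?n r R) = ?t r" if r: "r \<in> ?S" for r R
  proof -
    have r': "r permutes {1..?n}" using r by simp
    have q: "inv' r \<circ> p \<circ> r permutes {1..?n}"
      using r' p by (intro permutes_compose permutes_inv)
    show ?thesis
    proof (cases "p ` (r ` ?Z) = r ` ?Z")
      case True
      then have Z: "(inv' r \<circ> p \<circ> r) ` ?Z = ?Z" by (simp only: conj_preserves_iff[OF r'])
      then show ?thesis
        unfolding smat_conj[OF r' p] smat_in_B_block[OF q] B_block_character_smat[OF q Z a b]
          diag_char_conj[OF permutes_inj[OF r'] permutes_inj[OF p] True] block_term_def a b
        using True by (simp only: simp_thms if_True)
    next
      case False
      then have Z: "(inv' r \<circ> p \<circ> r) ` ?Z \<noteq> ?Z" unfolding conj_preserves_iff[OF r'] .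
      then show ?thesis
        unfolding smat_conj[OF r' p] smat_in_B_block[OF q] using False by (simp only: if_False)
    qed
  qed
  have "B_character ls ms ?g = (\<Sum>x\<in>carrier ?G. ?F x) / of_nat (card (B_block a b))"
    unfolding B_character_def induced_character_def Let_def a b B_group_simps
    using B.finite_carrier[of ?n] by (subst sum.inter_filter) auto
  also have "(\<Sum>x\<in>carrier ?G. ?F x) = (\<Sum>r\<in>?S. \<Sum>R\<in>Pow {1..?n}. ?t r)"
    unfolding sum_B_group by (intro sum.cong refl F)
  also have "\<dots> = 2 ^ ?n * (\<Sum>r\<in>?S. ?t r)"
    by (simp add: card_Pow sum_distrib_left)
  also have "(\<Sum>r\<in>?S. ?t r) = (\<Sum>r | r permutes {1..?n} \<and> p ` (r ` ?Z) = r ` ?Z.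
      diag_char (r ` ?Z) Y * block_term ls ms (inv' r \<circ> p \<circ> r))"
    using sum.inter_filter[of ?S "\<lambda>r. diag_char (r ` ?Z) Y * block_term ls ms (inv' r \<circ> p \<circ> r)" "\<lambda>r. p ` (r ` ?Z) = r ` ?Z"]
      finite_permutations[of "{1..?n}"] by simp
  finally show ?thesis by simp
qed

text \<open>
  The dependence of the character on the signs \<open>Y\<close> is through the characters \<open>r ` {a+1..a+b}\<close> of the
  diagonal subgroup only, so summing over \<open>Y\<close> produces the coefficients of \<open>f\<close> in the idempotent basis.
  The scalar in front is the same for all partitions of \<open>a\<close> and \<open>b\<close>.
\<close>

lemma linear_extension_B_character:
  assumes a: "sum_list ls = a" and b: "sum_list ms = b"
  shows "linear_extension (B_group (a + b)) (B_character ls ms) f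
    = 2 ^ (a + b) / of_nat (card (B_block a b)) *
      (\<Sum>p | p permutes {1..a + b}. \<Sum>r | r permutes {1..a + b} \<and> p ` (r ` {a+1..a+b}) = r ` {a+1..a+b}.
        block_term ls ms (inv' r \<circ> p \<circ> r) * fourier (a + b) f p (r ` {a+1..a+b}))"
  unfolding linear_extension_B_group sum_distrib_left
proof (intro sum.cong refl)
  let ?n = "a + b" and ?Z = "{a+1..a+b}" and ?C = "2 ^ (a + b) / of_nat (card (B_block a b)) :: complex"
  fix p assume "p \<in> {p. p permutes {1..?n}}"
  then have p: "p permutes {1..?n}" by simp
  let ?R = "{r. r permutes {1..?n} \<and> p ` (r ` ?Z) = r ` ?Z}"
  have "(\<Sum>Y\<in>Pow {1..?n}. f (smat ?n p Y) * B_character ls ms (smat ?n p Y))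
    = (\<Sum>Y\<in>Pow {1..?n}. \<Sum>r\<in>?R. ?C * (block_term ls ms (inv' r \<circ> p \<circ> r) * (diag_char (r ` ?Z) Y * f (smat ?n p Y))))"
    unfolding B_character_smat[OF p a b] sum_distrib_left by (intro sum.cong refl) (simp only: mult_ac)
  also have "\<dots> = (\<Sum>r\<in>?R. \<Sum>Y\<in>Pow {1..?n}. ?C * (block_term ls ms (inv' r \<circ> p \<circ> r) * (diag_char (r ` ?Z) Y * f (smat ?n p Y))))"
    by (rule sum.swap)
  also have "\<dots> = (\<Sum>r\<in>?R. ?C * (block_term ls ms (inv' r \<circ> p \<circ> r) * fourier ?n f p (r ` ?Z)))"
    by (simp only: fourier_def sum_distrib_left)
  finally show "(\<Sum>Y\<in>Pow {1..?n}. f (smat ?n p Y) * B_character ls ms (smat ?n p Y)) = \<dots>" .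
qed

text \<open>
  The contributions of \<open>r\<close> and of its inverse \<open>r'\<close> cancel in the cocycle identity because \<open>p\<close> preserves
  \<open>r ` Z\<close>.
\<close>

lemma inversion_sign_conj:
  assumes r: "inj r" and p: "inj p" and ri: "inj_on r' UNIV" "\<And>k. r' (r k) = k" "\<And>k. r (r' k) = k"
    and Z: "p ` (r ` Z) = r ` Z"
  shows "inversion_sign Z (r' \<circ> p \<circ> r) = inversion_sign (r ` Z) p"
proof -
  \<comment> \<open>Apply the cocycle identity to \<open>p = r \<circ> (r' \<circ> p)\<close>.\<close>
  have "inversion_sign (r ` Z) (r \<circ> (r' \<circ> p)) = inversion_sign ((r' \<circ> p) ` r ` Z) r * inversion_sign (r ` Z) (r' \<circ> p)"
    using r p ri(1) by (intro inversion_sign_comp) (auto intro: inj_on_subset inj_compose)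
  moreover have "r \<circ> (r' \<circ> p) = p" by (simp add: fun_eq_iff ri)
  moreover have "(r' \<circ> p) ` r ` Z = Z"
    unfolding image_comp[symmetric] Z by (simp add: image_image ri)
  ultimately have "inversion_sign (r ` Z) p = inversion_sign Z r * inversion_sign (r ` Z) (r' \<circ> p)"
    by (simp only:)
  moreover have "inversion_sign Z (r' \<circ> p \<circ> r) = inversion_sign (r ` Z) (r' \<circ> p) * inversion_sign Z r"
    using r p ri(1) by (intro inversion_sign_comp) (auto intro: inj_on_subset inj_compose)
  ultimately show ?thesis by (simp only: mult.commute)
qed

theorem proposition3p2:
  fixes n a b :: nat and lam mu :: "nat list"
  assumes "n \<ge> 1"
    and "partition_of a lam"
    and "partition_of b mu"
    and "a + b = n"
  shows "\<forall>x \<in> carrier (group_algebra (B_group n)).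
           linear_extension (B_group n) (B_character lam mu) (eta_phi n x)
         = linear_extension (B_group n) (B_character lam (conjugate_partition mu)) x"
proof
  fix x assume x: "x \<in> carrier (group_algebra (B_group n))"
  let ?Z = "{a+1..a+b}"
  have la: "sum_list lam = a" and mb: "sum_list mu = b"
    using assms(2,3) by (auto simp: partition_of_def)
  have cb: "sum_list (conjugate_partition mu) = b"
    using sym_character_conjugate(2)[OF assms(3) permutes_id] .
  have n: "n = a + b" using assms(4) by simp
  have key: "block_term lam mu (inv' r \<circ> p \<circ> r) * fourier n (eta_phi n x) p (r ` ?Z)
    = block_term lam (conjugate_partition mu) (inv' r \<circ> p \<circ> r) * fourier n x p (r ` ?Z)"
    if p: "p permutes {1..n}" and r: "r permutes {1..n}" and Z: "p ` (r ` ?Z) = r ` ?Z" for p r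
  proof -
    let ?q = "inv' r \<circ> p \<circ> r"
    have q: "?q permutes {1..a + b}"
      using r p unfolding n by (intro permutes_compose permutes_inv)
    have qZ: "?q ` ?Z = ?Z" using Z by (simp only: conj_preserves_iff[OF r])
    have rZ: "r ` ?Z \<subseteq> {1..n}" using permutes_image[OF r] n by (metis atLeastatMost_subset_iff image_mono le_add2 order_refl)
    have "sign (lower_part a b ?q) = inversion_sign ?Z ?q" by (rule sign_lower_part[OF q qZ])
    also have "\<dots> = inversion_sign (r ` ?Z) p"
      using Z by (intro inversion_sign_conj permutes_inj[OF r] permutes_inj[OF p] permutes_inj_on[OF permutes_inv[OF r]]
        permutes_inverses[OF r])
    finally have "sym_character (conjugate_partition mu) (lower_part a b ?q)
      = of_int (inversion_sign (r ` ?Z) p) * sym_character mu (lower_part a b ?q)"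
      using sym_character_conjugate(1)[OF assms(3) lower_part_permutes[OF q qZ]] by (simp only:)
    then show ?thesis
      unfolding block_term_def la mb cb eta_phi_eq_sign_twist[OF x] fourier_sign_twist[OF p rZ]
      by (simp only: mult_ac)
  qed
  show "linear_extension (B_group n) (B_character lam mu) (eta_phi n x)
    = linear_extension (B_group n) (B_character lam (conjugate_partition mu)) x"
    unfolding n linear_extension_B_character[OF la mb] linear_extension_B_character[OF la cb]
  proof (rule arg_cong2[where f = "(*)", OF refl], intro sum.cong refl)
    fix p r assume "p \<in> {p. p permutes {1..a + b}}"
      "r \<in> {r. r permutes {1..a + b} \<and> p ` (r ` ?Z) = r ` ?Z}"
    then show "block_term lam mu (inv' r \<circ> p \<circ> r) * fourier (a + b) (eta_phi (a + b) x) p (r ` ?Z)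
      = block_term lam (conjugate_partition mu) (inv' r \<circ> p \<circ> r) * fourier (a + b) x p (r ` ?Z)"
      using key[of p r] unfolding n by blast
  qed
qed

end
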